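(* Suppose that the following statement (A) is true. (A) For every $n\geq 1$ and all reduced holomorphic function-germs $f,g\colon(\mathbb{C}^n,0)\to (\mathbb{C},0)$: if there is a germ of homeomorphism $\varphi\colon(\mathbb{C}^n,0)\to (\mathbb{C}^n,0)$ such that $f=g\circ \varphi$, then $m(V(f),0)\equiv m(V(g),0) \pmod 2$. Then the following statement (B) is true. (B) For every $n\geq 1$ and all reduced holomorphic function-germs $f,g\colon(\mathbb{C}^n,0)\to (\mathbb{C},0)$: if there is a germ of homeomorphism $\varphi\colon(\mathbb{C}^n,0)\to (\mathbb{C}^n,0)$ such that $f=g\circ \varphi$, then $m(V(f),0)=m(V(g),0)$.
   Context: A holomorphic function-germ $f\colon(\mathbb{C}^n,0)\to(\mathbb{C},0)$, not identically zero, is written $f=f_m+f_{m+1}+\cdots$, where each $f_j$ is identically zero or a homogeneous polynomial of degree $j$, and $f_m\neq 0$; then $\mathrm{ord}_0 f:=m$. A germ is reduced if it is not identically zero and has no repeated irreducible factor. $(V(f),0)$ is the germ at $0$ of the zero set of $f$, and for $f$ reduced its multiplicity at the origin is $m(V(f),0):=\mathrm{ord}_0 f$. *)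

theory Defs
  imports "HOL-Analysis.Analysis" "HOL-Algebra.Ring_Divisibility" "HOL-Number_Theory.Cong"
begin

text \<open>The dimension has to be quantified inside formulas, so complex \<open>n\<close>-space is encoded
  with an explicit carrier, in the same way as \<^const>\<open>Euclidean_space\<close>. It carries the subspace
  topology of the product topology on \<^typ>\<open>nat \<Rightarrow> complex\<close>, which is the usual topology.\<close>

definition Cn :: "nat \<Rightarrow> (nat \<Rightarrow> complex) set"
  where "Cn n = {x. \<forall>i\<ge>n. x i = 0}"

abbreviation origin :: "nat \<Rightarrow> complex"
  where "origin \<equiv> \<lambda>_. 0"

definition near_origin :: "nat \<Rightarrow> (nat \<Rightarrow> complex) filter"
  where "near_origin n = nhdsin (top_of_set (Cn n)) origin"

definition multi_indices :: "nat \<Rightarrow> (nat \<Rightarrow> nat) set"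
  where "multi_indices n = {\<alpha>. \<forall>i\<ge>n. \<alpha> i = 0}"

definition monomial :: "nat \<Rightarrow> (nat \<Rightarrow> nat) \<Rightarrow> (nat \<Rightarrow> complex) \<Rightarrow> complex"
  where "monomial n \<alpha> x = (\<Prod>i<n. x i ^ \<alpha> i)"


text \<open>Holomorphic functions of \<open>n\<close> variables: every point is the centre of a polydisc on which
  the function is the sum of an (unconditionally, hence absolutely) convergent power series.\<close>

definition holomorphic_Cn :: "nat \<Rightarrow> (nat \<Rightarrow> complex) set \<Rightarrow> ((nat \<Rightarrow> complex) \<Rightarrow> complex) \<Rightarrow> bool"
  where "holomorphic_Cn n U f \<longleftrightarrow>
    (\<forall>a\<in>U. \<exists>c. \<exists>r>0. \<forall>x\<in>Cn n. (\<forall>i<n. cmod (x i - a i) < r) \<longrightarrow>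
       ((\<lambda>\<alpha>. c \<alpha> * monomial n \<alpha> (\<lambda>i. x i - a i)) has_sum f x) (multi_indices n))"

text \<open>\<open>f\<close> represents a germ at the origin; its values away from the origin are irrelevant.\<close>

definition holomorphic_germ :: "nat \<Rightarrow> ((nat \<Rightarrow> complex) \<Rightarrow> complex) \<Rightarrow> bool"
  where "holomorphic_germ n f \<longleftrightarrow>
    (\<exists>U. openin (top_of_set (Cn n)) U \<and> origin \<in> U \<and> holomorphic_Cn n U f)"

definition germ :: "nat \<Rightarrow> ((nat \<Rightarrow> complex) \<Rightarrow> complex) \<Rightarrow> ((nat \<Rightarrow> complex) \<Rightarrow> complex) set"
  where "germ n f = {g. eventually (\<lambda>x. g x = f x) (near_origin n)}"

definition germ_ring :: "nat \<Rightarrow> ((nat \<Rightarrow> complex) \<Rightarrow> complex) set ring"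
  where "germ_ring n =
    \<lparr>carrier = germ n ` {f. holomorphic_germ n f},
     mult = (\<lambda>A B. \<Union>f\<in>A. \<Union>g\<in>B. germ n (\<lambda>x. f x * g x)),
     one = germ n (\<lambda>_. 1),
     zero = germ n (\<lambda>_. 0),
     add = (\<lambda>A B. \<Union>f\<in>A. \<Union>g\<in>B. germ n (\<lambda>x. f x + g x))\<rparr>"

lemma germ_eq_iff: "germ n f = germ n g \<longleftrightarrow> eventually (\<lambda>x. f x = g x) (near_origin n)"
proof
  assume "germ n f = germ n g"
  moreover have "f \<in> germ n f" by (simp add: germ_def)
  ultimately show "eventually (\<lambda>x. f x = g x) (near_origin n)" by (simp add: germ_def)
next
  assume ev: "eventually (\<lambda>x. f x = g x) (near_origin n)"
  have "eventually (\<lambda>x. h x = f x) (near_origin n) \<longleftrightarrow> eventually (\<lambda>x. h x = g x) (near_origin n)" for h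
    by (rule eventually_subst, rule eventually_mono[OF ev]) simp
  then show "germ n f = germ n g" by (simp add: germ_def)
qed

lemma germ_ring_mult:
  "germ n f \<otimes>\<^bsub>germ_ring n\<^esub> germ n g = germ n (\<lambda>x. f x * g x)"
proof -
  have "germ n (\<lambda>x. f' x * g' x) = germ n (\<lambda>x. f x * g x)"
    if "f' \<in> germ n f" "g' \<in> germ n g" for f' g'
  proof -
    have "eventually (\<lambda>x. f' x = f x) (near_origin n)" "eventually (\<lambda>x. g' x = g x) (near_origin n)"
      using that by (simp_all add: germ_def)
    then show ?thesis
      unfolding germ_eq_iff by (rule eventually_elim2) simp
  qed
  moreover have "f \<in> germ n f" "g \<in> germ n g" by (simp_all add: germ_def)
  ultimately have "(\<Union>f'\<in>germ n f. \<Union>g'\<in>germ n g. germ n (\<lambda>x. f' x * g' x)) =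
      germ n (\<lambda>x. f x * g x)"
    by blast
  then show ?thesis by (simp add: germ_ring_def)
qed

lemma germ_ring_add:
  "germ n f \<oplus>\<^bsub>germ_ring n\<^esub> germ n g = germ n (\<lambda>x. f x + g x)"
proof -
  have "germ n (\<lambda>x. f' x + g' x) = germ n (\<lambda>x. f x + g x)"
    if "f' \<in> germ n f" "g' \<in> germ n g" for f' g'
  proof -
    have "eventually (\<lambda>x. f' x = f x) (near_origin n)" "eventually (\<lambda>x. g' x = g x) (near_origin n)"
      using that by (simp_all add: germ_def)
    then show ?thesis
      unfolding germ_eq_iff by (rule eventually_elim2) simp
  qed
  moreover have "f \<in> germ n f" "g \<in> germ n g" by (simp_all add: germ_def)
  ultimately have "(\<Union>f'\<in>germ n f. \<Union>g'\<in>germ n g. germ n (\<lambda>x. f' x + g' x)) =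
      germ n (\<lambda>x. f x + g x)"
    by blast
  then show ?thesis by (simp add: germ_ring_def)
qed

definition reduced_germ :: "nat \<Rightarrow> ((nat \<Rightarrow> complex) \<Rightarrow> complex) \<Rightarrow> bool"
  where "reduced_germ n f \<longleftrightarrow>
    germ n f \<noteq> \<zero>\<^bsub>germ_ring n\<^esub> \<and>
    \<not> (\<exists>p\<in>carrier (germ_ring n). ring_irreducible\<^bsub>germ_ring n\<^esub> p \<and>
          (p \<otimes>\<^bsub>germ_ring n\<^esub> p) divides\<^bsub>germ_ring n\<^esub> germ n f)"


text \<open>This includes the zero function, for every degree \<open>j\<close>.\<close>

definition homogeneous_poly :: "nat \<Rightarrow> nat \<Rightarrow> ((nat \<Rightarrow> complex) \<Rightarrow> complex) \<Rightarrow> bool"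
  where "homogeneous_poly n j P \<longleftrightarrow>
    (\<exists>c. \<forall>x\<in>Cn n. P x = (\<Sum>\<alpha> | \<alpha> \<in> multi_indices n \<and> (\<Sum>i<n. \<alpha> i) = j. c \<alpha> * monomial n \<alpha> x))"

text \<open>Meaningful only for germs of holomorphic functions that are not identically zero.\<close>

definition germ_ord :: "nat \<Rightarrow> ((nat \<Rightarrow> complex) \<Rightarrow> complex) \<Rightarrow> nat"
  where "germ_ord n f = (THE m. \<exists>P.
    (\<forall>j. homogeneous_poly n j (P j)) \<and>
    eventually (\<lambda>x. (\<lambda>j. P j x) sums f x) (near_origin n) \<and>
    (\<forall>j<m. \<forall>x\<in>Cn n. P j x = 0) \<and>
    (\<exists>x\<in>Cn n. P m x \<noteq> 0))"

text \<open>The multiplicity at the origin of the zero set of a reduced germ \<open>f\<close>.\<close>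

definition zero_set_mult :: "nat \<Rightarrow> ((nat \<Rightarrow> complex) \<Rightarrow> complex) \<Rightarrow> nat"
  where "zero_set_mult n f = germ_ord n f"

definition homeo_germ :: "nat \<Rightarrow> ((nat \<Rightarrow> complex) \<Rightarrow> (nat \<Rightarrow> complex)) \<Rightarrow> bool"
  where "homeo_germ n \<phi> \<longleftrightarrow> \<phi> origin = origin \<and>
    (\<exists>U V \<psi>. openin (top_of_set (Cn n)) U \<and> openin (top_of_set (Cn n)) V \<and>
       origin \<in> U \<and> origin \<in> V \<and> homeomorphism U V \<phi> \<psi>)"

definition topologically_right_equivalent ::
    "nat \<Rightarrow> ((nat \<Rightarrow> complex) \<Rightarrow> complex) \<Rightarrow> ((nat \<Rightarrow> complex) \<Rightarrow> complex) \<Rightarrow> bool"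
  where "topologically_right_equivalent n f g \<longleftrightarrow>
    (\<exists>\<phi>. homeo_germ n \<phi> \<and> germ n f = germ n (g \<circ> \<phi>))"

end

theory Submission
  imports Defs "HOL-Complex_Analysis.Complex_Analysis"
begin

text \<open>Adding a power \<open>z\<^sup>k\<close> of a new variable truncates orders: \<open>f + z\<^sup>k\<close> has order
  \<open>min (ord f) k\<close>, it is topologically equivalent to \<open>g + z\<^sup>k\<close> as soon as \<open>f\<close> is to \<open>g\<close>, and it is
  reduced whenever \<open>f\<close> is nonzero and \<open>f 0 = 0\<close>. If the orders of \<open>f\<close> and \<open>g\<close>
  were different, then with \<open>k\<close> the smaller of them plus 1 the truncated orders would be \<open>k - 1\<close> and \<open>k\<close>, which have different parity.\<close>

section \<open>Unconditional sums over lists\<close>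

text \<open>Both statements range over all dimensions, so (A) may be applied one dimension up. The
  delicate point there is reducedness. What is exploited about a repeated irreducible factor
  \<open>p\<close> is that it is not a unit, and this has to be turned into
  \<open>p origin = 0\<close>: a germ with nonzero value must be shown to have a holomorphic
  inverse. Since holomorphy means a power series at every nearby centre, the series of the inverse
  is constructed explicitly. Its terms are naturally indexed by lists of multi-indices, hence the
  sums over lists. Once \<open>p origin = 0\<close> is known, the question is one about a single
  complex variable, the new one, with the old variables as parameters.\<close>

lemma has_sum_group:
  fixes f :: "'a \<Rightarrow> 'b::banach"
  assumes "(f has_sum s) A" and "\<And>x. x \<in> A \<Longrightarrow> g x \<in> B"
  shows "((\<lambda>b. infsum f {x \<in> A. g x = b}) has_sum s) B"
proof (rule has_sum_SigmaD)
  \<comment> \<open>\<open>A\<close> is the disjoint union of the fibres of \<open>g\<close>; each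
    fibre sum exists because the target space is complete.\<close>
  have "bij_betw snd (Sigma B (\<lambda>b. {x \<in> A. g x = b})) A"
    using assms(2) by (intro bij_betw_byWitness[where f' = "\<lambda>x. (g x, x)"]) auto
  then show "((\<lambda>p. f (snd p)) has_sum s) (Sigma B (\<lambda>b. {x \<in> A. g x = b}))"
    using assms(1) by (simp only: has_sum_reindex_bij_betw)
  show "((\<lambda>x. f (snd (b, x))) has_sum infsum f {x \<in> A. g x = b}) {x \<in> A. g x = b}" for b
    using summable_on_subset_banach[OF has_sum_imp_summable[OF assms(1)], of "{x \<in> A. g x = b}"]
    by (simp add: has_sum_infsum)
qed

lemma has_sum_mult_Times:
  fixes f :: "'a \<Rightarrow> 'c::{real_normed_field, banach}"
  assumes "(f has_sum s) A" "(\<lambda>x. norm (f x)) summable_on A"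
    "(g has_sum t) B" "(\<lambda>x. norm (g x)) summable_on B"
  shows "((\<lambda>(x, y). f x * g y) has_sum s * t) (A \<times> B)"
proof (rule has_sum_SigmaI)
  show "((\<lambda>y. case (x, y) of (x, y) \<Rightarrow> f x * g y) has_sum f x * t) B" for x
    using has_sum_cmult_right[OF assms(3)] by simp
  show "((\<lambda>x. f x * t) has_sum s * t) A"
    using assms(1) by (rule has_sum_cmult_left)
  \<comment> \<open>Iterated sums alone do not yield a sum over the product; the product of the two
    sums of norms supplies the missing summability.\<close>
  have *: "(\<lambda>p. norm (f (fst p)) * norm (g (snd p))) summable_on A \<times> B"
  proof (rule summable_on_SigmaI)
    show "((\<lambda>y. norm (f (fst (x, y))) * norm (g (snd (x, y)))) has_sum
        norm (f x) * (\<Sum>\<^sub>\<infinity>y\<in>B. norm (g y))) B" for x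
      using has_sum_cmult_right[OF has_sum_infsum[OF assms(4)]] by simp
    show "(\<lambda>x. norm (f x) * (\<Sum>\<^sub>\<infinity>y\<in>B. norm (g y))) summable_on A"
      using assms(2) by (rule summable_on_cmult_left)
  qed simp
  show "(\<lambda>(x, y). f x * g y) summable_on A \<times> B"
    by (rule abs_summable_summable) (use * in \<open>simp add: case_prod_unfold norm_mult\<close>)
qed

text \<open>Multiplying out \<open>s ^ k\<close> gives one product per list of length
  \<open>k\<close>. The sum of the norms is carried through the induction because each further
  multiplication needs absolute summability.\<close>

lemma has_sum_prod_list_length:
  fixes f :: "'a \<Rightarrow> 'c::{real_normed_field, banach}"
  assumes "(f has_sum s) A" "((\<lambda>x. norm (f x)) has_sum q) A"
  shows "((\<lambda>l. prod_list (map f l)) has_sum s ^ k) {l \<in> lists A. length l = k} \<and>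
    ((\<lambda>l. norm (prod_list (map f l))) has_sum q ^ k) {l \<in> lists A. length l = k}"
proof (induction k)
  case 0
  have "{l \<in> lists A. length l = 0} = {[]}" by auto
  then show ?case by (simp add: has_sum_finiteI)
next
  case (Suc k)
  let ?L = "\<lambda>k. {l \<in> lists A. length l = k}"
  have bij: "bij_betw (\<lambda>(x, l). x # l) (A \<times> ?L k) (?L (Suc k))"
    by (intro bij_betw_byWitness[where f' = "\<lambda>l. (hd l, tl l)"]) (auto simp: length_Suc_conv)
  have abs: "(\<lambda>x. norm (f x)) summable_on A"
    "(\<lambda>l. norm (prod_list (map f l))) summable_on ?L k"
    by (rule has_sum_imp_summable[OF assms(2)], rule has_sum_imp_summable[OF conjunct2[OF Suc]])
  have "((\<lambda>(x, l). f x * prod_list (map f l)) has_sum s * s ^ k) (A \<times> ?L k)"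
    by (rule has_sum_mult_Times[OF assms(1) abs(1) conjunct1[OF Suc] abs(2)])
  moreover have "((\<lambda>(x, l). norm (f x) * norm (prod_list (map f l))) has_sum q * q ^ k) (A \<times> ?L k)"
    by (rule has_sum_mult_Times[OF assms(2) _ conjunct2[OF Suc]]) (simp_all add: abs)
  ultimately show ?case
    using has_sum_reindex_bij_betw[OF bij, of "\<lambda>l. prod_list (map f l)" "s ^ Suc k"]
      has_sum_reindex_bij_betw[OF bij, of "\<lambda>l. norm (prod_list (map f l))" "q ^ Suc k"]
    by (simp add: case_prod_unfold norm_mult)
qed

text \<open>Splitting the lists by length leaves the geometric series in \<open>s\<close>. The bound
  is on the sum of norms \<open>q\<close>, so that the fully expanded family over all lists is
  absolutely summable.\<close>

lemma has_sum_prod_list: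
  fixes f :: "'a \<Rightarrow> 'c::{real_normed_field, banach}"
  assumes s: "(f has_sum s) A" and q: "((\<lambda>x. norm (f x)) has_sum q) A" and "q < 1"
  shows "((\<lambda>l. prod_list (map f l)) has_sum 1 / (1 - s)) (lists A)"
proof -
  let ?L = "\<lambda>k. {l \<in> lists A. length l = k}"
  have q0: "0 \<le> q" using q by (rule has_sum_nonneg) simp
  have sq: "norm s \<le> q" using norm_has_sum_bound[OF q s] .
  have bij: "bij_betw snd (Sigma UNIV ?L) (lists A)"
    by (intro bij_betw_byWitness[where f' = "\<lambda>l. (length l, l)"]) auto
  have "(\<lambda>p. norm (prod_list (map f (snd p)))) summable_on Sigma UNIV ?L"
  proof (rule summable_on_SigmaI)
    show "((\<lambda>l. norm (prod_list (map f (snd (k, l))))) has_sum q ^ k) (?L k)" for k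
      using has_sum_prod_list_length[OF s q] by simp
    show "(\<lambda>k. q ^ k) summable_on UNIV"
      using q0 \<open>q < 1\<close> by (intro norm_summable_imp_summable_on) (simp add: summable_geometric)
  qed simp
  then have "(\<lambda>p. prod_list (map f (snd p))) summable_on Sigma UNIV ?L"
    by (rule abs_summable_summable)
  moreover have "((\<lambda>k. s ^ k) has_sum 1 / (1 - s)) UNIV"
  proof (rule norm_summable_imp_has_sum)
    show "summable (\<lambda>k. norm (s ^ k))"
      using sq \<open>q < 1\<close> by (simp add: norm_power summable_geometric)
    show "(\<lambda>k. s ^ k) sums (1 / (1 - s))"
      using sq \<open>q < 1\<close> by (intro geometric_sums) simp
  qed
  ultimately have "((\<lambda>p. prod_list (map f (snd p))) has_sum 1 / (1 - s)) (Sigma UNIV ?L)"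
    using has_sum_prod_list_length[OF s q] by (intro has_sum_SigmaI[where g = "\<lambda>k. s ^ k"]) auto
  then show ?thesis
    using has_sum_reindex_bij_betw[OF bij, of "\<lambda>l. prod_list (map f l)"] by simp
qed

section \<open>Power series in several variables\<close>

text \<open>The condition inside \<open>holomorphic_Cn\<close> at one centre, with coefficients and
  radius exposed so that they can be tracked.\<close>

definition expands ::
    "nat \<Rightarrow> ((nat \<Rightarrow> nat) \<Rightarrow> complex) \<Rightarrow> real \<Rightarrow> (nat \<Rightarrow> complex) \<Rightarrow> ((nat \<Rightarrow> complex) \<Rightarrow> complex) \<Rightarrow> bool"
  where "expands n c r a f \<longleftrightarrow> (\<forall>x\<in>Cn n. (\<forall>i<n. cmod (x i - a i) < r) \<longrightarrow>
    ((\<lambda>\<alpha>. c \<alpha> * monomial n \<alpha> (\<lambda>i. x i - a i)) has_sum f x) (multi_indices n))"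

definition mdeg :: "nat \<Rightarrow> (nat \<Rightarrow> nat) \<Rightarrow> nat"
  where "mdeg n \<alpha> = (\<Sum>i<n. \<alpha> i)"

lemma holomorphic_Cn_iff: "holomorphic_Cn n U f \<longleftrightarrow> (\<forall>a\<in>U. \<exists>c. \<exists>r>0. expands n c r a f)"
  unfolding holomorphic_Cn_def expands_def ..

lemma expandsD:
  assumes "expands n c r a f" "x \<in> Cn n" "\<And>i. i < n \<Longrightarrow> cmod (x i - a i) < r"
  shows "((\<lambda>\<alpha>. c \<alpha> * monomial n \<alpha> (\<lambda>i. x i - a i)) has_sum f x) (multi_indices n)"
  using assms unfolding expands_def by blast

lemma monomial_add: "monomial n (\<lambda>i. \<alpha> i + \<beta> i) x = monomial n \<alpha> x * monomial n \<beta> x"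
  by (simp add: monomial_def power_add prod.distrib)

lemma monomial_const: "(\<And>i. i < n \<Longrightarrow> x i = z) \<Longrightarrow> monomial n \<alpha> x = z ^ mdeg n \<alpha>"
  by (simp add: monomial_def mdeg_def power_sum)

lemma monomial_scale: "monomial n \<alpha> (\<lambda>i. t * x i) = t ^ mdeg n \<alpha> * monomial n \<alpha> x"
  by (simp add: monomial_def mdeg_def power_sum power_mult_distrib prod.distrib)

lemma norm_monomial_le:
  assumes "\<And>i. i < n \<Longrightarrow> cmod (x i) \<le> \<rho>"
  shows "cmod (monomial n \<alpha> x) \<le> \<rho> ^ mdeg n \<alpha>"
  unfolding monomial_def mdeg_def power_sum prod_norm[symmetric] norm_power
  using assms by (intro prod_mono) (auto intro: power_mono)

lemma mdeg_eq_0_iff: "\<alpha> \<in> multi_indices n \<Longrightarrow> mdeg n \<alpha> = 0 \<longleftrightarrow> \<alpha> = (\<lambda>_. 0)"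
  by (force simp: mdeg_def multi_indices_def fun_eq_iff not_less[symmetric])

lemma monomial_zero: "\<alpha> \<in> multi_indices n \<Longrightarrow> monomial n \<alpha> (\<lambda>_. 0) = (if \<alpha> = (\<lambda>_. 0) then 1 else 0)"
  using mdeg_eq_0_iff[of \<alpha> n] by (auto simp: monomial_const)

text \<open>A nonconstant monomial has positive degree, so shrinking the polydisc by
  \<open>t\<close> gains at least one factor \<open>t\<close>. This gain drives both the convergence
  of the inverse series and continuity at the origin.\<close>

lemma norm_monomial_le_scaled:
  assumes "\<And>i. i < n \<Longrightarrow> cmod (x i) \<le> t * \<rho>" "0 \<le> t" "t \<le> 1" "0 \<le> \<rho>"
    and "\<alpha> \<in> multi_indices n" "\<alpha> \<noteq> (\<lambda>_. 0)"
  shows "cmod (monomial n \<alpha> x) \<le> t * \<rho> ^ mdeg n \<alpha>"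
proof -
  have "0 < mdeg n \<alpha>" using mdeg_eq_0_iff assms by blast
  then have "t ^ mdeg n \<alpha> \<le> t ^ 1" using assms by (intro power_decreasing) auto
  have "cmod (monomial n \<alpha> x) \<le> (t * \<rho>) ^ mdeg n \<alpha>"
    using assms by (intro norm_monomial_le)
  also have "\<dots> \<le> t * \<rho> ^ mdeg n \<alpha>"
    using \<open>t ^ mdeg n \<alpha> \<le> t ^ 1\<close> assms by (simp add: power_mult_distrib mult_right_mono)
  finally show ?thesis .
qed

lemma monomial_Suc: "monomial (Suc n) \<alpha> x = monomial n \<alpha> x * x n ^ \<alpha> n"
  by (simp add: monomial_def)

lemma monomial_cong: "(\<And>i. i < n \<Longrightarrow> x i = y i) \<Longrightarrow> monomial n \<alpha> x = monomial n \<alpha> y"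
  by (simp add: monomial_def)

lemma expands_center:
  assumes "expands n c r a f" "0 < r" "a \<in> Cn n"
  shows "f a = c (\<lambda>_. 0)"
proof (rule has_sum_unique)
  show "((\<lambda>\<alpha>. c \<alpha> * monomial n \<alpha> (\<lambda>_. 0)) has_sum f a) (multi_indices n)"
    using expandsD[OF assms(1,3)] \<open>0 < r\<close> by simp
  show "((\<lambda>\<alpha>. c \<alpha> * monomial n \<alpha> (\<lambda>_. 0)) has_sum c (\<lambda>_. 0)) (multi_indices n)"
    by (rule has_sum_finite_neutralI[where B = "{\<lambda>_. 0}"])
      (auto simp: monomial_zero multi_indices_def)
qed

text \<open>At the point whose first \<open>n\<close> coordinates are \<open>a i + \<rho>\<close>
  every monomial becomes \<open>\<rho> ^ mdeg n \<alpha>\<close>, and unconditional summability of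
  complex numbers is absolute.\<close>

lemma expands_abs_summable:
  assumes "expands n c r a f" "0 < \<rho>" "\<rho> < r" "a \<in> Cn n"
  shows "(\<lambda>\<alpha>. cmod (c \<alpha>) * \<rho> ^ mdeg n \<alpha>) summable_on multi_indices n"
proof -
  let ?x = "\<lambda>i. if i < n then a i + of_real \<rho> else 0"
  have "((\<lambda>\<alpha>. c \<alpha> * monomial n \<alpha> (\<lambda>i. ?x i - a i)) has_sum f ?x) (multi_indices n)"
    using assms by (intro expandsD[OF assms(1)]) (auto simp: Cn_def)
  moreover have "monomial n \<alpha> (\<lambda>i. ?x i - a i) = of_real \<rho> ^ mdeg n \<alpha>" for \<alpha>
    by (rule monomial_const) simp
  ultimately have "(\<lambda>\<alpha>. c \<alpha> * of_real \<rho> ^ mdeg n \<alpha>) summable_on multi_indices n"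
    using has_sum_imp_summable by force
  then have "(\<lambda>\<alpha>. cmod (c \<alpha> * of_real \<rho> ^ mdeg n \<alpha>)) summable_on multi_indices n"
    by (rule summable_on_iff_abs_summable_on_complex[THEN iffD1])
  then show ?thesis
    using \<open>0 < \<rho>\<close> by (simp add: norm_mult norm_power)
qed

lemma prod_list_monomial:
  "prod_list (map (\<lambda>\<alpha>. h \<alpha> * monomial n \<alpha> y) l) =
    prod_list (map h l) * monomial n (\<lambda>i. \<Sum>\<alpha>\<leftarrow>l. \<alpha> i) y"
proof (induction l)
  case Nil
  then show ?case by (simp add: monomial_def)
next
  case (Cons \<alpha> l)
  then show ?case
    using monomial_add[of n \<alpha> "\<lambda>i. \<Sum>\<alpha>\<leftarrow>l. \<alpha> i" y] by (simp add: mult_ac)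
qed

text \<open>Normalising \<open>f a = 1\<close>, the series of \<open>1 / f = 1 / (1 - h)\<close> is the geometric series in \<open>h\<close>;
  its fully expanded terms are indexed by the lists of multi-indices, which are then grouped by
  their sum.\<close>

lemma expands_inverse:
  assumes f: "expands n c r a f" and "0 < r" "a \<in> Cn n" "f a \<noteq> 0"
  shows "\<exists>c' r'. 0 < r' \<and> expands n c' r' a (\<lambda>x. 1 / f x)"
proof -
  let ?I = "multi_indices n"
  define h where "h \<alpha> = (if \<alpha> = (\<lambda>_. 0) then 0 else - c \<alpha> / f a)" for \<alpha>
  define \<rho> where "\<rho> = r / 2"
  have \<rho>: "0 < \<rho>" "\<rho> < r" using \<open>0 < r\<close> by (auto simp: \<rho>_def)
  have ca: "c (\<lambda>_. 0) = f a" using expands_center[OF f] assms by simp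
  have "(\<lambda>\<alpha>. cmod (h \<alpha>) * \<rho> ^ mdeg n \<alpha>) summable_on ?I"
  proof (rule summable_on_comparison_test)
    show "(\<lambda>\<alpha>. 1 / cmod (f a) * (cmod (c \<alpha>) * \<rho> ^ mdeg n \<alpha>)) summable_on ?I"
      by (intro summable_on_cmult_right expands_abs_summable[OF f] assms \<rho>)
  qed (use \<rho> in \<open>auto simp: h_def norm_divide\<close>)
  then obtain M where M: "((\<lambda>\<alpha>. cmod (h \<alpha>) * \<rho> ^ mdeg n \<alpha>) has_sum M) ?I"
    using has_sum_infsum by blast
  then have "0 \<le> M" by (rule has_sum_nonneg) (use \<rho> in auto)
  \<comment> \<open>All terms of \<open>h\<close> have positive degree, so on the polydisc of radius
    \<open>t * \<rho>\<close> their norms add up to at most \<open>t * M\<close>, which this choice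
    keeps below 1. Adding 2 instead of 1 also gives \<open>t < 1\<close> when
    \<open>M = 0\<close>.\<close>
  define t where "t = 1 / (M + 2)"
  have t: "0 < t" "t < 1" "t * M < 1"
    using \<open>0 \<le> M\<close> by (auto simp: t_def field_simps)
  \<comment> \<open>The coefficient of the monomial \<open>\<alpha>\<close> collects the lists that
    add up to \<open>\<alpha>\<close>. There are infinitely many, since the zero index may be
    repeated, but \<open>h\<close> vanishes at that index.\<close>
  define c' where "c' \<alpha> = (\<Sum>\<^sub>\<infinity>l \<in> {l \<in> lists ?I. (\<lambda>i. \<Sum>\<beta>\<leftarrow>l. \<beta> i) = \<alpha>}. prod_list (map h l)) / f a" for \<alpha>
  have "expands n c' (t * \<rho>) a (\<lambda>x. 1 / f x)"
    unfolding expands_def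
  proof (intro ballI impI)
    fix x assume x: "x \<in> Cn n" "\<forall>i<n. cmod (x i - a i) < t * \<rho>"
    let ?y = "\<lambda>i. x i - a i"
    define u where "u \<alpha> = h \<alpha> * monomial n \<alpha> ?y" for \<alpha>
    have "t * \<rho> < r" using t \<rho> by (intro le_less_trans[OF mult_left_le_one_le]) auto
    have "((\<lambda>\<alpha>. c \<alpha> * monomial n \<alpha> ?y) has_sum f x) ?I"
      using x \<open>t * \<rho> < r\<close> by (intro expandsD[OF f]) force+
    then have "((\<lambda>\<alpha>. - 1 / f a * (c \<alpha> * monomial n \<alpha> ?y)) has_sum - 1 / f a * f x) ?I"
      by (rule has_sum_cmult_right)
    moreover have "((\<lambda>\<alpha>. if \<alpha> = (\<lambda>_. 0) then 1 else 0) has_sum (1::complex)) ?I"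
      by (rule has_sum_finite_neutralI[where B = "{\<lambda>_. 0}"]) (auto simp: multi_indices_def)
    ultimately have "((\<lambda>\<alpha>. - 1 / f a * (c \<alpha> * monomial n \<alpha> ?y) + (if \<alpha> = (\<lambda>_. 0) then 1 else 0))
        has_sum - 1 / f a * f x + 1) ?I"
      by (rule has_sum_add)
    moreover have "- 1 / f a * (c \<alpha> * monomial n \<alpha> ?y) + (if \<alpha> = (\<lambda>_. 0) then 1 else 0) = u \<alpha>" for \<alpha>
      using ca \<open>f a \<noteq> 0\<close> by (auto simp: u_def h_def monomial_def)
    ultimately have u: "(u has_sum 1 - f x / f a) ?I"
      by (simp add: algebra_simps)
    have bound: "cmod (u \<alpha>) \<le> t * (cmod (h \<alpha>) * \<rho> ^ mdeg n \<alpha>)" if "\<alpha> \<in> ?I" for \<alpha>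
    proof (cases "\<alpha> = (\<lambda>_. 0)")
      case False
      with x t \<rho> that have "cmod (monomial n \<alpha> ?y) \<le> t * \<rho> ^ mdeg n \<alpha>"
        by (intro norm_monomial_le_scaled) (auto intro: less_imp_le)
      then have "cmod (h \<alpha>) * cmod (monomial n \<alpha> ?y) \<le> cmod (h \<alpha>) * (t * \<rho> ^ mdeg n \<alpha>)"
        by (rule mult_left_mono) simp
      then show ?thesis
        by (simp add: u_def norm_mult mult.left_commute)
    qed (use t \<rho> in \<open>simp add: u_def h_def\<close>)
    obtain q where q: "((\<lambda>\<alpha>. cmod (u \<alpha>)) has_sum q) ?I"
      using has_sum_imp_summable[OF u] summable_on_iff_abs_summable_on_complex has_sum_infsum by blast
    have "q \<le> t * M"
      using q has_sum_cmult_right[OF M] bound by (rule has_sum_mono)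
    then have "q < 1" using t by simp
    have "((\<lambda>l. prod_list (map u l)) has_sum 1 / (1 - (1 - f x / f a))) (lists ?I)"
      using u q \<open>q < 1\<close> by (rule has_sum_prod_list)
    then have "((\<lambda>\<alpha>. infsum (\<lambda>l. prod_list (map u l)) {l \<in> lists ?I. (\<lambda>i. \<Sum>\<beta>\<leftarrow>l. \<beta> i) = \<alpha>})
        has_sum f a / f x) ?I"
      by (intro has_sum_group) (auto simp: multi_indices_def in_lists_conv_set sum_list_0
          intro!: sum_list_eq_0_iff[THEN iffD2])
    then have "((\<lambda>\<alpha>. 1 / f a * infsum (\<lambda>l. prod_list (map u l))
        {l \<in> lists ?I. (\<lambda>i. \<Sum>\<beta>\<leftarrow>l. \<beta> i) = \<alpha>}) has_sum 1 / f a * (f a / f x)) ?I"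
      by (rule has_sum_cmult_right)
    moreover have "infsum (\<lambda>l. prod_list (map u l)) {l \<in> lists ?I. (\<lambda>i. \<Sum>\<beta>\<leftarrow>l. \<beta> i) = \<alpha>}
        = c' \<alpha> * f a * monomial n \<alpha> ?y" for \<alpha>
    proof -
      have "infsum (\<lambda>l. prod_list (map u l)) {l \<in> lists ?I. (\<lambda>i. \<Sum>\<beta>\<leftarrow>l. \<beta> i) = \<alpha>} =
          infsum (\<lambda>l. prod_list (map h l) * monomial n \<alpha> ?y) {l \<in> lists ?I. (\<lambda>i. \<Sum>\<beta>\<leftarrow>l. \<beta> i) = \<alpha>}"
        unfolding u_def prod_list_monomial by (rule infsum_cong) auto
      then show ?thesis
        using \<open>f a \<noteq> 0\<close> by (simp add: c'_def infsum_cmult_left')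
    qed
    ultimately show "((\<lambda>\<alpha>. c' \<alpha> * monomial n \<alpha> ?y) has_sum 1 / f x) ?I"
      using \<open>f a \<noteq> 0\<close> by simp
  qed
  moreover have "0 < t * \<rho>" using t \<rho> by simp
  ultimately show ?thesis by blast
qed

section \<open>Germs of holomorphic functions\<close>

lemma origin_in_Cn: "origin \<in> Cn n"
  by (simp add: Cn_def)

lemma eventually_near_origin_openin:
  "eventually P (near_origin n) \<longleftrightarrow>
    (\<exists>U. openin (top_of_set (Cn n)) U \<and> origin \<in> U \<and> (\<forall>x\<in>U. P x))"
  by (simp add: near_origin_def eventually_nhdsin origin_in_Cn)

lemma openin_polydisc: "openin (top_of_set (Cn n)) {x \<in> Cn n. \<forall>i<n. cmod (x i) < r}"
proof -
  have "open (\<Inter>i<n. {x::nat \<Rightarrow> complex. cmod (x i) < r})"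
    by (intro open_INT ballI open_Collect_less continuous_on_norm continuous_on_const
        continuous_on_product_coordinates) simp
  moreover have "{x \<in> Cn n. \<forall>i<n. cmod (x i) < r} = Cn n \<inter> (\<Inter>i<n. {x. cmod (x i) < r})"
    by auto
  ultimately show ?thesis by (simp only: openin_open_Int)
qed

lemma openin_contains_polydisc:
  assumes "openin (top_of_set (Cn n)) U" "origin \<in> U"
  shows "\<exists>r>0. \<forall>x\<in>Cn n. (\<forall>i<n. cmod (x i) < r) \<longrightarrow> x \<in> U"
proof -
  obtain T where T: "open T" "U = Cn n \<inter> T"
    using assms(1) by (auto simp: openin_open)
  then have "openin (product_topology (\<lambda>_::nat. euclidean::complex topology) UNIV) T"
    by (simp add: euclidean_product_topology flip: open_openin)
  moreover have "origin \<in> T" using assms(2) T(2) by blast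
  ultimately obtain X where X: "origin \<in> (\<Pi>\<^sub>E i\<in>UNIV. X i)" "\<And>i. open (X i)" "(\<Pi>\<^sub>E i\<in>UNIV. X i) \<subseteq> T"
    using product_topology_open_contains_basis[of "\<lambda>_. euclidean" UNIV T origin] by auto
  have "\<exists>e>0. ball 0 e \<subseteq> X i" for i
    using X by (metis PiE_E UNIV_I open_contains_ball)
  then obtain e where e: "\<And>i. 0 < e i" "\<And>i. ball 0 (e i) \<subseteq> X i"
    by metis
  \<comment> \<open>Beyond \<open>n\<close> all coordinates of points of \<open>Cn n\<close> are 0,
    so finitely many radii matter; the extra 1 keeps the minimum meaningful for
    \<open>n = 0\<close>.\<close>
  define r where "r = Min (insert 1 (e ` {..<n}))"
  have "0 < r" "\<And>i. i < n \<Longrightarrow> r \<le> e i"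
    using e(1) by (auto simp: r_def)
  moreover have "0 \<in> X i" for i using X(1) by auto
  ultimately have "x i \<in> X i" if "x \<in> Cn n" "\<forall>i<n. cmod (x i) < r" for x i
    using that e(2)[of i] by (cases "i < n") (force simp: Cn_def)+
  then have "x \<in> U" if "x \<in> Cn n" "\<forall>i<n. cmod (x i) < r" for x
    using that X(3) T(2) by blast
  with \<open>0 < r\<close> show ?thesis by blast
qed

lemma eventually_near_origin:
  "eventually P (near_origin n) \<longleftrightarrow>
    (\<exists>r>0. \<forall>x\<in>Cn n. (\<forall>i<n. cmod (x i) < r) \<longrightarrow> P x)"
proof
  assume "eventually P (near_origin n)"
  then show "\<exists>r>0. \<forall>x\<in>Cn n. (\<forall>i<n. cmod (x i) < r) \<longrightarrow> P x"
    unfolding eventually_near_origin_openin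
    by (blast dest: openin_contains_polydisc)
next
  assume "\<exists>r>0. \<forall>x\<in>Cn n. (\<forall>i<n. cmod (x i) < r) \<longrightarrow> P x"
  then obtain r where "0 < r" "\<forall>x\<in>{x \<in> Cn n. \<forall>i<n. cmod (x i) < r}. P x" by blast
  then show "eventually P (near_origin n)"
    unfolding eventually_near_origin_openin
    by (intro exI[of _ "{x \<in> Cn n. \<forall>i<n. cmod (x i) < r}"])
      (auto simp: openin_polydisc origin_in_Cn)
qed

lemma holomorphic_germ_iff:
  "holomorphic_germ n f \<longleftrightarrow> eventually (\<lambda>a. \<exists>c. \<exists>r>0. expands n c r a f) (near_origin n)"
  unfolding holomorphic_germ_def holomorphic_Cn_iff eventually_near_origin_openin ..

lemma holomorphic_germ_expands:
  "holomorphic_germ n f \<Longrightarrow> \<exists>c. \<exists>r>0. expands n c r origin f"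
  unfolding holomorphic_germ_def holomorphic_Cn_iff by blast

text \<open>\<open>M\<close> is the value of the majorant series at radius \<rho>; each nonconstant
  term gains a factor \<open>t\<close>. Taking \<open>t = 1\<close> gives boundedness, small
  \<open>t\<close> gives continuity at the origin.\<close>

lemma expands_Lipschitz:
  assumes f: "expands n c r origin f" and \<rho>: "0 < \<rho>" "\<rho> < r"
  shows "\<exists>M\<ge>0. \<forall>t x. 0 \<le> t \<longrightarrow> t \<le> 1 \<longrightarrow> x \<in> Cn n \<longrightarrow> (\<forall>i<n. cmod (x i) \<le> t * \<rho>) \<longrightarrow>
    cmod (f x - f origin) \<le> t * M"
proof -
  let ?I = "multi_indices n"
  obtain M where M: "((\<lambda>\<alpha>. cmod (c \<alpha>) * \<rho> ^ mdeg n \<alpha>) has_sum M) ?I"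
    using expands_abs_summable[OF f \<rho> origin_in_Cn] has_sum_infsum by blast
  then have "0 \<le> M" by (rule has_sum_nonneg) (use \<rho> in auto)
  moreover have "cmod (f x - f origin) \<le> t * M"
    if "0 \<le> t" "t \<le> 1" "x \<in> Cn n" "\<forall>i<n. cmod (x i) \<le> t * \<rho>" for t x
  proof -
    define u where "u \<alpha> = (if \<alpha> = (\<lambda>_. 0) then 0 else c \<alpha> * monomial n \<alpha> x)" for \<alpha>
    have "t * \<rho> < r" using that \<rho> by (intro le_less_trans[OF mult_left_le_one_le]) auto
    have "((\<lambda>\<alpha>. c \<alpha> * monomial n \<alpha> x) has_sum f x) ?I"
      using expandsD[OF f, of x] that \<open>t * \<rho> < r\<close> by force
    moreover have "((\<lambda>\<alpha>. if \<alpha> = (\<lambda>_. 0) then - f origin else 0) has_sum - f origin) ?I"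
      by (rule has_sum_finite_neutralI[where B = "{\<lambda>_. 0}"]) (auto simp: multi_indices_def)
    ultimately have "((\<lambda>\<alpha>. c \<alpha> * monomial n \<alpha> x + (if \<alpha> = (\<lambda>_. 0) then - f origin else 0))
        has_sum f x + - f origin) ?I"
      by (rule has_sum_add)
    moreover have "c \<alpha> * monomial n \<alpha> x + (if \<alpha> = (\<lambda>_. 0) then - f origin else 0) = u \<alpha>" for \<alpha>
      using expands_center[OF f _ origin_in_Cn] \<rho> by (simp add: u_def monomial_def)
    ultimately have u: "(u has_sum f x - f origin) ?I"
      by simp
    then obtain q where q: "((\<lambda>\<alpha>. cmod (u \<alpha>)) has_sum q) ?I"
      using has_sum_infsum[OF summable_on_iff_abs_summable_on_complex[THEN iffD1, OF has_sum_imp_summable]]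
      by blast
    have bound: "cmod (u \<alpha>) \<le> t * (cmod (c \<alpha>) * \<rho> ^ mdeg n \<alpha>)" if "\<alpha> \<in> ?I" for \<alpha>
    proof (cases "\<alpha> = (\<lambda>_. 0)")
      case False
      have "cmod (monomial n \<alpha> x) \<le> t * \<rho> ^ mdeg n \<alpha>"
        using norm_monomial_le_scaled[of n x t \<rho> \<alpha>] False
          \<open>0 \<le> t\<close> \<open>t \<le> 1\<close> \<open>\<forall>i<n. cmod (x i) \<le> t * \<rho>\<close> \<rho> that by simp
      then have "cmod (c \<alpha>) * cmod (monomial n \<alpha> x) \<le> cmod (c \<alpha>) * (t * \<rho> ^ mdeg n \<alpha>)"
        by (rule mult_left_mono) simp
      then show ?thesis using False by (simp add: u_def norm_mult mult.left_commute)
    qed (use \<open>0 \<le> t\<close> \<rho> in \<open>simp add: u_def\<close>)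
    have "q \<le> t * M"
      using q has_sum_cmult_right[OF M] bound by (rule has_sum_mono)
    then show ?thesis using norm_has_sum_bound[OF q u] by simp
  qed
  ultimately show ?thesis by blast
qed

lemma expands_bounded:
  assumes "expands n c r origin f" "0 < \<rho>" "\<rho> < r"
  shows "\<exists>M>0. \<forall>x\<in>Cn n. (\<forall>i<n. cmod (x i) \<le> \<rho>) \<longrightarrow> cmod (f x) \<le> M"
proof -
  obtain M where M: "0 \<le> M" "\<And>x. x \<in> Cn n \<Longrightarrow> \<forall>i<n. cmod (x i) \<le> \<rho> \<Longrightarrow> cmod (f x - f origin) \<le> M"
    using expands_Lipschitz[OF assms] by (auto dest!: spec[of _ "1::real"])
  have "cmod (f x) \<le> M + cmod (f origin) + 1" if "x \<in> Cn n" "\<forall>i<n. cmod (x i) \<le> \<rho>" for x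
    using M(2)[OF that] norm_triangle_sub[of "f x" "f origin"] by simp
  moreover have "0 < M + cmod (f origin) + 1"
    using M(1) by (intro add_nonneg_pos add_nonneg_nonneg) auto
  ultimately show ?thesis by blast
qed

lemma holomorphic_germ_tendsto:
  assumes "holomorphic_germ n f"
  shows "(f \<longlongrightarrow> f origin) (near_origin n)"
proof (rule tendstoI)
  fix e :: real assume "0 < e"
  obtain c r where f: "expands n c r origin f" and "0 < r"
    using holomorphic_germ_expands[OF assms] by blast
  then obtain M where "0 \<le> M" and M: "\<And>t x. 0 \<le> t \<Longrightarrow> t \<le> 1 \<Longrightarrow> x \<in> Cn n \<Longrightarrow>
      \<forall>i<n. cmod (x i) \<le> t * (r / 2) \<Longrightarrow> cmod (f x - f origin) \<le> t * M"
    using expands_Lipschitz[OF f, of "r / 2"] by auto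
  \<comment> \<open>The summand 1 avoids a division by 0 and makes \<open>t * M < e\<close>
    strict.\<close>
  define t where "t = min 1 (e / (M + 1))"
  have t: "0 < t" "t \<le> 1" using \<open>0 < e\<close> \<open>0 \<le> M\<close> by (auto simp: t_def)
  have "t * M < e"
  proof -
    have "t * M < t * (M + 1)" using t by simp
    also have "\<dots> \<le> e / (M + 1) * (M + 1)" using \<open>0 \<le> M\<close> by (intro mult_right_mono) (auto simp: t_def)
    also have "\<dots> = e" using \<open>0 \<le> M\<close> by simp
    finally show ?thesis .
  qed
  show "eventually (\<lambda>x. dist (f x) (f origin) < e) (near_origin n)"
    unfolding eventually_near_origin
  proof (intro exI conjI ballI impI)
    show "0 < t * (r / 2)" using t \<open>0 < r\<close> by simp
    fix x assume "x \<in> Cn n" "\<forall>i<n. cmod (x i) < t * (r / 2)"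
    then have "cmod (f x - f origin) \<le> t * M" using t by (intro M) (auto intro: less_imp_le)
    then show "dist (f x) (f origin) < e" using \<open>t * M < e\<close> by (simp add: dist_norm)
  qed
qed

text \<open>An expansion is required at every nearby centre \<open>a\<close>, not only at the
  origin; continuity keeps \<open>f a\<close> nonzero there, so the inverse series exists at each of
  them.\<close>

lemma holomorphic_germ_inverse:
  assumes "holomorphic_germ n f" "f origin \<noteq> 0"
  shows "holomorphic_germ n (\<lambda>x. 1 / f x)"
proof -
  have "eventually (\<lambda>x. f x \<noteq> 0) (near_origin n)"
    using holomorphic_germ_tendsto[OF assms(1)] assms(2) by (rule tendsto_imp_eventually_ne)
  moreover have "eventually (\<lambda>a. \<exists>c. \<exists>r>0. expands n c r a f) (near_origin n)"
    using assms(1) by (simp only: holomorphic_germ_iff)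
  moreover have "eventually (\<lambda>x. x \<in> Cn n) (near_origin n)"
    unfolding eventually_near_origin using zero_less_one by blast
  ultimately show ?thesis
    unfolding holomorphic_germ_iff
  proof eventually_elim
    case (elim a)
    then show ?case using expands_inverse[of n _ _ a f] by blast
  qed
qed

text \<open>Grouping the terms by the exponent of the last variable leaves a power series in
  \<open>z\<close> alone. This is the passage to one-variable complex analysis.\<close>

lemma expands_holomorphic_slice:
  assumes f: "expands (Suc n) c r origin f" and x: "x \<in> Cn n" "\<And>i. i < n \<Longrightarrow> cmod (x i) < r"
  shows "(\<lambda>z. f (x(n := z))) holomorphic_on ball 0 r"
proof (rule power_series_holomorphic)
  fix z :: complex assume z: "z \<in> ball 0 r"
  let ?I = "multi_indices (Suc n)"
  have mono: "monomial (Suc n) \<alpha> (x(n := z)) = monomial n \<alpha> x * z ^ \<alpha> n" for \<alpha>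
    using monomial_cong[of n "x(n := z)" x \<alpha>] by (simp add: monomial_Suc)
  have "x(n := z) \<in> Cn (Suc n)" "\<And>i. i < Suc n \<Longrightarrow> cmod ((x(n := z)) i - 0) < r"
    using x z by (auto simp: Cn_def less_Suc_eq)
  from expandsD[OF f this]
  have "((\<lambda>\<alpha>. c \<alpha> * monomial (Suc n) \<alpha> (x(n := z))) has_sum f (x(n := z))) ?I"
    by (simp del: fun_upd_apply)
  then have "((\<lambda>j. infsum (\<lambda>\<alpha>. c \<alpha> * monomial (Suc n) \<alpha> (x(n := z))) {\<alpha> \<in> ?I. \<alpha> n = j})
      has_sum f (x(n := z))) UNIV"
    by (rule has_sum_group) simp
  moreover have "infsum (\<lambda>\<alpha>. c \<alpha> * monomial (Suc n) \<alpha> (x(n := z))) {\<alpha> \<in> ?I. \<alpha> n = j} =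
      infsum (\<lambda>\<alpha>. c \<alpha> * monomial n \<alpha> x) {\<alpha> \<in> ?I. \<alpha> n = j} * (z - 0) ^ j" for j
    unfolding infsum_cmult_left'[symmetric] mono by (rule infsum_cong) (simp add: mult_ac)
  ultimately show "(\<lambda>j. infsum (\<lambda>\<alpha>. c \<alpha> * monomial n \<alpha> x) {\<alpha> \<in> ?I. \<alpha> n = j} * (z - 0) ^ j)
      sums f (x(n := z))"
    using has_sum_imp_sums by simp
qed

section \<open>Suspension\<close>

text \<open>The new variable is the coordinate with index \<open>n\<close>, and
  \<open>x(n := 0)\<close> is the projection of \<open>Cn (Suc n)\<close> onto \<open>Cn n\<close>,
  which is a subset of it in this encoding.\<close>

definition suspension :: "nat \<Rightarrow> nat \<Rightarrow> ((nat \<Rightarrow> complex) \<Rightarrow> complex) \<Rightarrow> (nat \<Rightarrow> complex) \<Rightarrow> complex"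
  where "suspension n k f x = f (x(n := 0)) + x n ^ k"

lemma upd_in_Cn_iff: "x(n := 0) \<in> Cn n \<longleftrightarrow> x \<in> Cn (Suc n)"
  by (auto simp: Cn_def Suc_le_eq nat_less_le)

lemma Cn_mono_Suc: "x \<in> Cn n \<Longrightarrow> x \<in> Cn (Suc n)"
  by (simp add: Cn_def)

lemma eventually_near_origin_upd:
  assumes "eventually P (near_origin n)"
  shows "eventually (\<lambda>x. P (x(n := 0))) (near_origin (Suc n))"
proof -
  obtain r where "0 < r" and r: "\<And>x. x \<in> Cn n \<Longrightarrow> \<forall>i<n. cmod (x i) < r \<Longrightarrow> P x"
    using assms unfolding eventually_near_origin by blast
  have "P (x(n := 0))" if "x \<in> Cn (Suc n)" "\<forall>i<Suc n. cmod (x i) < r" for x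
    using that by (intro r) (auto simp: upd_in_Cn_iff)
  with \<open>0 < r\<close> show ?thesis
    unfolding eventually_near_origin by blast
qed

lemma multi_indices_subset_Suc: "multi_indices n \<subseteq> multi_indices (Suc n)"
  by (auto simp: multi_indices_def)

lemma multi_indices_Suc_iff:
  assumes "\<alpha> n = 0"
  shows "\<alpha> \<in> multi_indices (Suc n) \<longleftrightarrow> \<alpha> \<in> multi_indices n"
proof -
  have "Suc n \<le> i \<or> i = n" if "n \<le> i" for i using that by linarith
  then show ?thesis using assms unfolding multi_indices_def by fastforce
qed

lemma multi_indices_last: "\<alpha> \<in> multi_indices n \<Longrightarrow> \<alpha> n = 0"
  by (simp add: multi_indices_def)

abbreviation last_index :: "nat \<Rightarrow> nat \<Rightarrow> nat \<Rightarrow> nat"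
  where "last_index n j \<equiv> (\<lambda>_. 0)(n := j)"

lemma last_index_in_multi_indices: "last_index n j \<in> multi_indices (Suc n)"
  by (simp add: multi_indices_def)

lemma inj_last_index: "inj (last_index n)"
  by (rule injI) (metis fun_upd_same)

lemma monomial_last_index: "monomial (Suc n) (last_index n j) x = x n ^ j"
  by (simp add: monomial_def)

lemma mdeg_last_index: "mdeg (Suc n) (last_index n j) = j"
  by (simp add: mdeg_def)

lemma mdeg_Suc: "mdeg (Suc n) \<alpha> = mdeg n \<alpha> + \<alpha> n"
  by (simp add: mdeg_def)

lemma expands_suspension:
  assumes f: "expands n c r (a(n := 0)) f"
  shows "\<exists>c'. expands (Suc n) c' r a (suspension n k f)"
proof -
  let ?I = "multi_indices (Suc n)"
  define c1 where "c1 \<alpha> = (if \<alpha> n = 0 then c \<alpha> else 0)" for \<alpha>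
  \<comment> \<open>Binomial expansion of the \<open>k\<close>-th power of the last coordinate about
    \<open>a n\<close>, supported on the pure powers of the last variable. In \<open>c1\<close> the
    old coefficients are extended by zero to indices involving that variable.\<close>
  define c2 where "c2 \<alpha> = (if \<alpha> = last_index n (\<alpha> n)
    then of_nat (k choose \<alpha> n) * a n ^ (k - \<alpha> n) else 0)" for \<alpha>
  have "expands (Suc n) (\<lambda>\<alpha>. c1 \<alpha> + c2 \<alpha>) r a (suspension n k f)"
    unfolding expands_def
  proof (intro ballI impI)
    fix x assume x: "x \<in> Cn (Suc n)" "\<forall>i<Suc n. cmod (x i - a i) < r"
    let ?y = "\<lambda>i. x i - a i"
    have "((\<lambda>\<alpha>. c \<alpha> * monomial n \<alpha> (\<lambda>i. (x(n := 0)) i - (a(n := 0)) i)) has_sum f (x(n := 0)))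
        (multi_indices n)"
    proof (rule expandsD[OF f])
      show "x(n := 0) \<in> Cn n" using x upd_in_Cn_iff by blast
      show "cmod ((x(n := 0)) i - (a(n := 0)) i) < r" if "i < n" for i
        using x that by simp
    qed
    moreover have "monomial n \<alpha> (\<lambda>i. (x(n := 0)) i - (a(n := 0)) i) = monomial n \<alpha> ?y" for \<alpha>
      by (rule monomial_cong) simp
    ultimately have "((\<lambda>\<alpha>. c \<alpha> * monomial n \<alpha> ?y) has_sum f (x(n := 0))) (multi_indices n)"
      by (simp del: fun_upd_apply)
    also have "?this \<longleftrightarrow> ((\<lambda>\<alpha>. c1 \<alpha> * monomial (Suc n) \<alpha> ?y) has_sum f (x(n := 0))) ?I"
    proof (rule has_sum_cong_neutral)
      show "c1 \<alpha> * monomial (Suc n) \<alpha> ?y = 0" if "\<alpha> \<in> ?I - multi_indices n" for \<alpha>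
        using that multi_indices_Suc_iff[of \<alpha> n] by (auto simp: c1_def)
      show "c \<alpha> * monomial n \<alpha> ?y = 0" if "\<alpha> \<in> multi_indices n - ?I" for \<alpha>
        using that multi_indices_subset_Suc by blast
      show "c \<alpha> * monomial n \<alpha> ?y = c1 \<alpha> * monomial (Suc n) \<alpha> ?y" if "\<alpha> \<in> multi_indices n \<inter> ?I" for \<alpha>
        using that multi_indices_last[of \<alpha> n] by (simp add: c1_def monomial_Suc)
    qed
    finally have 1: "((\<lambda>\<alpha>. c1 \<alpha> * monomial (Suc n) \<alpha> ?y) has_sum f (x(n := 0))) ?I" .
    have 2: "((\<lambda>\<alpha>. c2 \<alpha> * monomial (Suc n) \<alpha> ?y) has_sum x n ^ k) ?I"
    proof (rule has_sum_finite_neutralI)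
      show "finite (last_index n ` {..k})" "last_index n ` {..k} \<subseteq> ?I"
        by (auto simp: last_index_in_multi_indices)
      show "c2 \<alpha> * monomial (Suc n) \<alpha> ?y = 0" if "\<alpha> \<in> ?I - last_index n ` {..k}" for \<alpha>
      proof (cases "\<alpha> n \<le> k")
        case True
        then have "\<alpha> \<noteq> last_index n (\<alpha> n)" using that by blast
        then show ?thesis by (simp add: c2_def)
      qed (simp add: c2_def binomial_eq_0)
      have "(\<Sum>\<alpha>\<in>last_index n ` {..k}. c2 \<alpha> * monomial (Suc n) \<alpha> ?y) =
          (\<Sum>j\<le>k. of_nat (k choose j) * ?y n ^ j * a n ^ (k - j))"
        using inj_on_subset[OF inj_last_index]
        by (subst sum.reindex) (auto simp: c2_def monomial_last_index mult_ac intro!: sum.cong)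
      also have "\<dots> = (?y n + a n) ^ k" by (rule binomial_ring[symmetric])
      finally show "x n ^ k = (\<Sum>\<alpha>\<in>last_index n ` {..k}. c2 \<alpha> * monomial (Suc n) \<alpha> ?y)" by simp
    qed
    show "((\<lambda>\<alpha>. (c1 \<alpha> + c2 \<alpha>) * monomial (Suc n) \<alpha> ?y) has_sum suspension n k f x) ?I"
      using has_sum_add[OF 1 2] by (simp add: suspension_def distrib_right)
  qed
  then show ?thesis by blast
qed

lemma holomorphic_germ_suspension:
  assumes "holomorphic_germ n f"
  shows "holomorphic_germ (Suc n) (suspension n k f)"
  unfolding holomorphic_germ_iff
  using eventually_near_origin_upd[OF assms[unfolded holomorphic_germ_iff]]
proof eventually_elim
  case (elim a)
  then show ?case using expands_suspension[of n _ _ a f k] by blast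
qed

lemma homeo_germ_suspension:
  assumes "homeo_germ n \<phi>"
  shows "homeo_germ (Suc n) (\<lambda>x. (\<phi> (x(n := 0)))(n := x n))"
proof -
  obtain U V \<psi> where U: "openin (top_of_set (Cn n)) U" "origin \<in> U"
    and V: "openin (top_of_set (Cn n)) V" "origin \<in> V"
    and hom: "homeomorphism U V \<phi> \<psi>" and "\<phi> origin = origin"
    using assms unfolding homeo_germ_def by blast
  \<comment> \<open>The cylinder over \<open>W\<close>, unbounded in the new direction. On it the
    map is the product of \<phi> with the identity, so its inverse is built in the same way from
    \<psi>.\<close>
  define S where "S W = {x. x(n := 0) \<in> W}" for W :: "(nat \<Rightarrow> complex) set"
  have cont_upd: "continuous_on A (\<lambda>x::nat \<Rightarrow> complex. x(n := 0))" for A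
  proof (rule continuous_on_coordinatewise_then_product)
    show "continuous_on A (\<lambda>x::nat \<Rightarrow> complex. (x(n := 0)) i)" for i
      by (cases "i = n") (auto intro: continuous_on_subset[OF continuous_on_product_coordinates])
  qed
  have S_open: "openin (top_of_set (Cn (Suc n))) (S W)" if W: "openin (top_of_set (Cn n)) W" for W
  proof -
    obtain T where T: "open T" "W = Cn n \<inter> T" using W by (auto simp: openin_open)
    have "open ((\<lambda>x. x(n := 0)) -` T)"
      using T(1) cont_upd[of UNIV] by (intro open_vimage)
    moreover have "S W = Cn (Suc n) \<inter> (\<lambda>x. x(n := 0)) -` T"
      unfolding S_def T(2) by (auto simp: upd_in_Cn_iff simp del: fun_upd_apply)
    ultimately show ?thesis by (simp only: openin_open_Int)
  qed
  have cont: "continuous_on (S W) (\<lambda>x. (h (x(n := 0)))(n := x n))"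
    if h: "continuous_on W h" for W and h :: "(nat \<Rightarrow> complex) \<Rightarrow> nat \<Rightarrow> complex"
  proof (rule continuous_on_coordinatewise_then_product)
    fix i
    have "continuous_on (S W) (\<lambda>x. h (x(n := 0)))"
      by (rule continuous_on_compose2[OF h cont_upd]) (auto simp: S_def)
    then have "continuous_on (S W) (\<lambda>x. h (x(n := 0)) i)"
      by (rule continuous_on_product_then_coordinatewise)
    then show "continuous_on (S W) (\<lambda>x. ((h (x(n := 0)))(n := x n)) i)"
      by (cases "i = n") (auto intro: continuous_on_subset[OF continuous_on_product_coordinates])
  qed
  have drop: "y(n := z, n := 0) = y" if "y \<in> Cn n" for y :: "nat \<Rightarrow> complex" and z
    using that by (auto simp: Cn_def)
  have sub: "U \<subseteq> Cn n" "V \<subseteq> Cn n"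
    using U V by (auto dest: openin_imp_subset)
  have hom': "\<phi> x \<in> V" "\<psi> (\<phi> x) = x" if "x \<in> U" for x
    using hom that by (auto simp: homeomorphism_def)
  have hom'': "\<psi> y \<in> U" "\<phi> (\<psi> y) = y" if "y \<in> V" for y
    using hom that by (auto simp: homeomorphism_def)
  have "homeomorphism (S U) (S V) (\<lambda>x. (\<phi> (x(n := 0)))(n := x n)) (\<lambda>x. (\<psi> (x(n := 0)))(n := x n))"
  proof (rule homeomorphismI)
    show "continuous_on (S U) (\<lambda>x. (\<phi> (x(n := 0)))(n := x n))"
      "continuous_on (S V) (\<lambda>x. (\<psi> (x(n := 0)))(n := x n))"
      using hom by (auto intro!: cont simp: homeomorphism_def)
    have *: "\<phi> (x(n := 0)) \<in> Cn n" if "x \<in> S U" for x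
      using that hom'(1) sub by (auto simp: S_def simp del: fun_upd_apply)
    have **: "\<psi> (x(n := 0)) \<in> Cn n" if "x \<in> S V" for x
      using that hom''(1) sub by (auto simp: S_def simp del: fun_upd_apply)
    show "(\<lambda>x. (\<phi> (x(n := 0)))(n := x n)) ` S U \<subseteq> S V"
      using * hom'(1) by (auto simp: S_def drop simp del: fun_upd_apply fun_upd_upd)
    show "(\<lambda>x. (\<psi> (x(n := 0)))(n := x n)) ` S V \<subseteq> S U"
      using ** hom''(1) by (auto simp: S_def drop simp del: fun_upd_apply fun_upd_upd)
    show "(\<psi> (((\<phi> (x(n := 0)))(n := x n))(n := 0)))(n := ((\<phi> (x(n := 0)))(n := x n)) n) = x"
      if "x \<in> S U" for x
      unfolding drop[OF *[OF that]] using that hom'(2)[of "x(n := 0)"] by (auto simp: S_def)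
    show "(\<phi> (((\<psi> (x(n := 0)))(n := x n))(n := 0)))(n := ((\<psi> (x(n := 0)))(n := x n)) n) = x"
      if "x \<in> S V" for x
      unfolding drop[OF **[OF that]] using that hom''(2)[of "x(n := 0)"] by (auto simp: S_def)
  qed
  moreover have "origin(n := 0) = origin" by auto
  ultimately show ?thesis
    unfolding homeo_germ_def using S_open[OF U(1)] S_open[OF V(1)] U(2) V(2) \<open>\<phi> origin = origin\<close>
    by (intro conjI exI[of _ "S U"] exI[of _ "S V"] exI[of _ "\<lambda>x. (\<psi> (x(n := 0)))(n := x n)"])
      (simp_all add: S_def)
qed

lemma topologically_right_equivalent_suspension:
  assumes "topologically_right_equivalent n f g"
  shows "topologically_right_equivalent (Suc n) (suspension n k f) (suspension n k g)"
proof -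
  obtain \<phi> where \<phi>: "homeo_germ n \<phi>" and fg: "eventually (\<lambda>x. f x = (g \<circ> \<phi>) x) (near_origin n)"
    using assms unfolding topologically_right_equivalent_def germ_eq_iff by blast
  \<comment> \<open>Membership in \<open>Cn n\<close> makes coordinate \<open>n\<close> of
    \<open>\<phi> x\<close> vanish, so overwriting it with \<open>x n\<close> and projecting back
    recovers \<open>\<phi> x\<close>.\<close>
  have "eventually (\<lambda>x. \<phi> x \<in> Cn n) (near_origin n)"
    using \<phi> unfolding homeo_germ_def eventually_near_origin_openin homeomorphism_def
    by (meson image_eqI openin_imp_subset subsetD)
  with fg have "eventually (\<lambda>x. f x = g (\<phi> x) \<and> \<phi> x \<in> Cn n) (near_origin n)"
    by eventually_elim simp
  from eventually_near_origin_upd[OF this]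
  have "eventually (\<lambda>x. suspension n k f x =
      (suspension n k g \<circ> (\<lambda>x. (\<phi> (x(n := 0)))(n := x n))) x) (near_origin (Suc n))"
  proof eventually_elim
    case (elim x)
    then have "(\<phi> (x(n := 0)))(n := x n, n := 0) = \<phi> (x(n := 0))"
      by (auto simp: Cn_def)
    with elim show ?case by (simp add: suspension_def)
  qed
  then show ?thesis
    unfolding topologically_right_equivalent_def germ_eq_iff
    using homeo_germ_suspension[OF \<phi>] by blast
qed

section \<open>Order\<close>

text \<open>The predicate under \<open>THE\<close> in \<open>germ_ord\<close>, isolated so that
  existence and uniqueness can be treated separately.\<close>

definition has_ord :: "nat \<Rightarrow> ((nat \<Rightarrow> complex) \<Rightarrow> complex) \<Rightarrow> nat \<Rightarrow> bool"
  where "has_ord n f m \<longleftrightarrow> (\<exists>P.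
    (\<forall>j. homogeneous_poly n j (P j)) \<and>
    eventually (\<lambda>x. (\<lambda>j. P j x) sums f x) (near_origin n) \<and>
    (\<forall>j<m. \<forall>x\<in>Cn n. P j x = 0) \<and>
    (\<exists>x\<in>Cn n. P m x \<noteq> 0))"

lemma homogeneous_poly_iff:
  "homogeneous_poly n j P \<longleftrightarrow>
    (\<exists>c. \<forall>x\<in>Cn n. P x = (\<Sum>\<alpha> | \<alpha> \<in> multi_indices n \<and> mdeg n \<alpha> = j. c \<alpha> * monomial n \<alpha> x))"
  unfolding homogeneous_poly_def mdeg_def ..

lemma finite_multi_indices_mdeg: "finite {\<alpha> \<in> multi_indices n. mdeg n \<alpha> = j}"
proof (rule finite_subset)
  have le: "\<alpha> i \<le> mdeg n \<alpha>" if "i < n" for \<alpha> i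
    using member_le_sum[of i "{..<n}" \<alpha>] that by (simp add: mdeg_def)
  show "{\<alpha> \<in> multi_indices n. mdeg n \<alpha> = j} \<subseteq>
      {\<alpha>. \<forall>i. (i \<in> {..<n} \<longrightarrow> \<alpha> i \<in> {..j}) \<and> (i \<notin> {..<n} \<longrightarrow> \<alpha> i = 0)}"
  proof
    fix \<alpha> assume "\<alpha> \<in> {\<alpha> \<in> multi_indices n. mdeg n \<alpha> = j}"
    then show "\<alpha> \<in> {\<alpha>. \<forall>i. (i \<in> {..<n} \<longrightarrow> \<alpha> i \<in> {..j}) \<and> (i \<notin> {..<n} \<longrightarrow> \<alpha> i = 0)}"
      using le[of _ \<alpha>] by (simp add: multi_indices_def)
  qed
  show "finite {\<alpha>. \<forall>i. (i \<in> {..<n} \<longrightarrow> \<alpha> i \<in> {..j}) \<and> (i \<notin> {..<n} \<longrightarrow> \<alpha> i = (0::nat))}"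
    by (rule finite_set_of_finite_funs) auto
qed

lemma homogeneous_poly_scale:
  assumes "homogeneous_poly n j P" "x \<in> Cn n"
  shows "P (\<lambda>i. t * x i) = P x * t ^ j"
proof -
  obtain c where c: "\<And>x. x \<in> Cn n \<Longrightarrow>
      P x = (\<Sum>\<alpha> | \<alpha> \<in> multi_indices n \<and> mdeg n \<alpha> = j. c \<alpha> * monomial n \<alpha> x)"
    using assms(1) unfolding homogeneous_poly_iff by blast
  have "(\<lambda>i. t * x i) \<in> Cn n" using assms(2) by (simp add: Cn_def)
  then show ?thesis
    using assms(2) unfolding c[OF assms(2)] sum_distrib_right
    by (simp add: c monomial_scale mult_ac)
qed

text \<open>Zeros of a nonzero power series that vanishes at its centre are isolated, whereas here
  the sum is 0 on a whole disc. The constant coefficient is handled first, because the isolation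
  result needs a nonzero coefficient of positive index.\<close>

lemma powser_zero_coeffs:
  fixes d :: "nat \<Rightarrow> complex"
  assumes "0 < r" "\<And>z. cmod z < r \<Longrightarrow> (\<lambda>j. d j * z ^ j) sums 0"
  shows "d j = 0"
proof (rule ccontr)
  assume "d j \<noteq> 0"
  have "d 0 = 0"
    using sums_unique2[OF powser_sums_zero[of d] assms(2)[of 0]] \<open>0 < r\<close> by simp
  with \<open>d j \<noteq> 0\<close> have "0 < j" by (cases j) auto
  show False
  proof (rule powser_0_nonzero[where a = d and \<xi> = 0 and f = "\<lambda>_. 0" and r = r and m = j])
    fix s :: real
    assume "0 < s" and s: "\<And>z::complex. z \<in> cball 0 s - {0} \<Longrightarrow> (0::complex) \<noteq> 0"
    then have "complex_of_real s \<in> cball 0 s - {0}" by simp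
    from s[OF this] show False by simp
  qed (use assms \<open>d j \<noteq> 0\<close> \<open>0 < j\<close> in auto)
qed

text \<open>Along each line through the origin the homogeneous expansion is a power series in one
  variable.\<close>

lemma homogeneous_expansion_unique:
  assumes P: "\<And>j. homogeneous_poly n j (P j)" "eventually (\<lambda>x. (\<lambda>j. P j x) sums f x) (near_origin n)"
    and Q: "\<And>j. homogeneous_poly n j (Q j)" "eventually (\<lambda>x. (\<lambda>j. Q j x) sums f x) (near_origin n)"
    and x: "x \<in> Cn n"
  shows "P j x = Q j x"
proof -
  have "eventually (\<lambda>x. (\<lambda>j. P j x - Q j x) sums 0) (near_origin n)"
    using P(2) Q(2) by eventually_elim (use sums_diff in fastforce)
  then obtain r where "0 < r"
    and r: "\<And>x. x \<in> Cn n \<Longrightarrow> \<forall>i<n. cmod (x i) < r \<Longrightarrow> (\<lambda>j. P j x - Q j x) sums 0"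
    unfolding eventually_near_origin by blast
  \<comment> \<open>\<open>B\<close> bounds all coordinates of \<open>x\<close>, so
    \<open>z * x i\<close> stays in the polydisc for \<open>cmod z < r / B\<close>; the summand 1
    keeps \<open>B\<close> positive at the origin.\<close>
  define B where "B = (\<Sum>i<n. cmod (x i)) + 1"
  have "0 < B" unfolding B_def by (intro add_nonneg_pos sum_nonneg) auto
  have B: "cmod (x i) < B" if "i < n" for i
    using member_le_sum[of i "{..<n}" "\<lambda>i. cmod (x i)"] that by (simp add: B_def)
  have "P j x - Q j x = 0"
  proof (rule powser_zero_coeffs)
    show "0 < r / B" using \<open>0 < r\<close> \<open>0 < B\<close> by simp
    fix z assume z: "cmod z < r / B"
    have "cmod (z * x i) < r" if "i < n" for i
    proof -
      have "cmod (z * x i) \<le> cmod z * B"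
        using B[OF that] by (simp add: norm_mult mult_left_mono)
      also have "\<dots> < r" using z \<open>0 < B\<close> by (simp add: field_simps)
      finally show ?thesis .
    qed
    moreover have "(\<lambda>i. z * x i) \<in> Cn n" using x by (simp add: Cn_def)
    ultimately have "(\<lambda>j. P j (\<lambda>i. z * x i) - Q j (\<lambda>i. z * x i)) sums 0"
      by (intro r) auto
    then show "(\<lambda>j. (P j x - Q j x) * z ^ j) sums 0"
      by (simp add: homogeneous_poly_scale[OF P(1) x] homogeneous_poly_scale[OF Q(1) x]
          left_diff_distrib)
  qed
  then show ?thesis by simp
qed

lemma has_ord_unique:
  assumes "has_ord n f m" "has_ord n f m'"
  shows "m = m'"
proof -
  obtain P where P: "\<And>j. homogeneous_poly n j (P j)"
    "eventually (\<lambda>x. (\<lambda>j. P j x) sums f x) (near_origin n)"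
    "\<And>j x. j < m \<Longrightarrow> x \<in> Cn n \<Longrightarrow> P j x = 0" "\<exists>x\<in>Cn n. P m x \<noteq> 0"
    using assms(1) unfolding has_ord_def by blast
  obtain Q where Q: "\<And>j. homogeneous_poly n j (Q j)"
    "eventually (\<lambda>x. (\<lambda>j. Q j x) sums f x) (near_origin n)"
    "\<And>j x. j < m' \<Longrightarrow> x \<in> Cn n \<Longrightarrow> Q j x = 0" "\<exists>x\<in>Cn n. Q m' x \<noteq> 0"
    using assms(2) unfolding has_ord_def by blast
  have PQ: "P j x = Q j x" if "x \<in> Cn n" for j x
    using homogeneous_expansion_unique[OF P(1,2) Q(1,2) that] .
  have "\<not> m < m'"
    using P(4) Q(3)[of m] PQ[of _ m] by auto
  moreover have "\<not> m' < m"
    using Q(4) P(3)[of m'] PQ[of _ m'] by auto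
  ultimately show ?thesis by simp
qed

lemma germ_ord_eq: "has_ord n f m \<Longrightarrow> germ_ord n f = m"
  unfolding germ_ord_def has_ord_def[symmetric]
  by (rule the_equality, assumption, rule has_ord_unique)

lemma germ_ring_zero: "\<zero>\<^bsub>germ_ring n\<^esub> = germ n (\<lambda>_. 0)"
  by (simp add: germ_ring_def)

text \<open>Grouping the series by total degree yields the homogeneous parts. If all of them
  vanished, so would the germ; hence there is a least degree with a nonzero part.\<close>

lemma has_ord_exists:
  assumes "holomorphic_germ n f" "germ n f \<noteq> \<zero>\<^bsub>germ_ring n\<^esub>"
  shows "\<exists>m. has_ord n f m"
proof -
  obtain c r where "0 < r" and f: "expands n c r origin f"
    using holomorphic_germ_expands[OF assms(1)] by blast
  define P where "P j x = (\<Sum>\<alpha> | \<alpha> \<in> multi_indices n \<and> mdeg n \<alpha> = j. c \<alpha> * monomial n \<alpha> x)" for j x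
  have hom: "homogeneous_poly n j (P j)" for j
    unfolding homogeneous_poly_iff P_def by blast
  have "(\<lambda>j. P j x) sums f x" if "x \<in> Cn n" "\<forall>i<n. cmod (x i) < r" for x
  proof -
    have "((\<lambda>\<alpha>. c \<alpha> * monomial n \<alpha> x) has_sum f x) (multi_indices n)"
      using expandsD[OF f, of x] that by simp
    then have "((\<lambda>j. infsum (\<lambda>\<alpha>. c \<alpha> * monomial n \<alpha> x) {\<alpha> \<in> multi_indices n. mdeg n \<alpha> = j})
        has_sum f x) UNIV"
      by (rule has_sum_group) simp
    then have "((\<lambda>j. P j x) has_sum f x) UNIV"
      by (simp add: P_def finite_multi_indices_mdeg)
    then show ?thesis by (rule has_sum_imp_sums)
  qed
  then have sums: "eventually (\<lambda>x. (\<lambda>j. P j x) sums f x) (near_origin n)"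
    unfolding eventually_near_origin using \<open>0 < r\<close> by blast
  have ex: "\<exists>j. \<exists>x\<in>Cn n. P j x \<noteq> 0"
  proof (rule ccontr)
    assume "\<not> ?thesis"
    then have zero: "\<And>x j. x \<in> Cn n \<Longrightarrow> P j x = 0" by blast
    have "eventually (\<lambda>x. x \<in> Cn n) (near_origin n)"
      unfolding eventually_near_origin using zero_less_one by blast
    with sums have "eventually (\<lambda>x. f x = 0) (near_origin n)"
    proof eventually_elim
      case (elim x)
      then have "(\<lambda>_. 0) sums f x" using zero by simp
      then show ?case using sums_unique2[OF _ sums_zero] by blast
    qed
    with assms(2) show False by (simp add: germ_ring_zero germ_eq_iff)
  qed
  define m where "m = (LEAST j. \<exists>x\<in>Cn n. P j x \<noteq> 0)"
  have "\<exists>x\<in>Cn n. P m x \<noteq> 0" unfolding m_def using ex by (rule LeastI_ex)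
  moreover have "P j x = 0" if "j < m" "x \<in> Cn n" for j x
    using not_less_Least[of j "\<lambda>j. \<exists>x\<in>Cn n. P j x \<noteq> 0"] that by (auto simp: m_def)
  ultimately show ?thesis unfolding has_ord_def using hom sums by blast
qed

section \<open>Homogeneous parts and order of a suspension\<close>

lemma homogeneous_poly_suspension:
  assumes "homogeneous_poly n j P"
  shows "homogeneous_poly (Suc n) j (\<lambda>x. P (x(n := 0)) + (if j = k then x n ^ k else 0))"
proof -
  obtain c where c: "\<And>x. x \<in> Cn n \<Longrightarrow>
      P x = (\<Sum>\<alpha> | \<alpha> \<in> multi_indices n \<and> mdeg n \<alpha> = j. c \<alpha> * monomial n \<alpha> x)"
    using assms unfolding homogeneous_poly_iff by blast
  let ?J = "{\<alpha> \<in> multi_indices n. mdeg n \<alpha> = j}"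
  let ?K = "{\<alpha> \<in> multi_indices (Suc n). mdeg (Suc n) \<alpha> = j}"
  define c1 where "c1 \<alpha> = (if \<alpha> n = 0 then c \<alpha> else 0)" for \<alpha>
  define c2 where "c2 \<alpha> = (if j = k \<and> \<alpha> = last_index n k then 1 else 0 :: complex)" for \<alpha>
  have "P (x(n := 0)) + (if j = k then x n ^ k else 0) =
      (\<Sum>\<alpha>\<in>?K. (c1 \<alpha> + c2 \<alpha>) * monomial (Suc n) \<alpha> x)" if x: "x \<in> Cn (Suc n)" for x
  proof -
    have "P (x(n := 0)) = (\<Sum>\<alpha>\<in>?J. c \<alpha> * monomial n \<alpha> (x(n := 0)))"
      by (rule c) (simp only: upd_in_Cn_iff x)
    also have "\<dots> = (\<Sum>\<alpha>\<in>?J. c1 \<alpha> * monomial (Suc n) \<alpha> x)"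
    proof (rule sum.cong)
      fix \<alpha> assume "\<alpha> \<in> ?J"
      then have "\<alpha> n = 0" using multi_indices_last[of \<alpha> n] by simp
      then show "c \<alpha> * monomial n \<alpha> (x(n := 0)) = c1 \<alpha> * monomial (Suc n) \<alpha> x"
        using monomial_cong[of n "x(n := 0)" x \<alpha>] by (simp add: c1_def monomial_Suc)
    qed simp
    also have "\<dots> = (\<Sum>\<alpha>\<in>?K. c1 \<alpha> * monomial (Suc n) \<alpha> x)"
    proof (rule sum.mono_neutral_left)
      show "finite ?K" by (rule finite_multi_indices_mdeg)
      show "?J \<subseteq> ?K"
      proof
        fix \<alpha> assume \<alpha>: "\<alpha> \<in> ?J"
        then have "mdeg (Suc n) \<alpha> = j"
          using multi_indices_last[of \<alpha> n] mdeg_Suc[of n \<alpha>] by simp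
        with \<alpha> show "\<alpha> \<in> ?K"
          using multi_indices_subset_Suc[of n] by blast
      qed
      show "\<forall>\<alpha>\<in>?K - ?J. c1 \<alpha> * monomial (Suc n) \<alpha> x = 0"
      proof
        fix \<alpha> assume \<alpha>: "\<alpha> \<in> ?K - ?J"
        have "\<alpha> n \<noteq> 0"
        proof
          assume 0: "\<alpha> n = 0"
          have "\<alpha> \<in> multi_indices n"
            using \<alpha> unfolding multi_indices_Suc_iff[of \<alpha> n, OF 0, symmetric] by blast
          moreover have "mdeg n \<alpha> = j"
            using \<alpha> 0 mdeg_Suc[of n \<alpha>] by simp
          ultimately show False using \<alpha> by blast
        qed
        then show "c1 \<alpha> * monomial (Suc n) \<alpha> x = 0" by (simp add: c1_def)
      qed
    qed
    finally have 1: "P (x(n := 0)) = (\<Sum>\<alpha>\<in>?K. c1 \<alpha> * monomial (Suc n) \<alpha> x)" .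
    have "(\<Sum>\<alpha>\<in>?K. c2 \<alpha> * monomial (Suc n) \<alpha> x) =
        (\<Sum>\<alpha>\<in>?K. if \<alpha> = last_index n k then (if j = k then x n ^ k else 0) else 0)"
      by (intro sum.cong) (auto simp: c2_def monomial_last_index)
    also have "\<dots> = (if j = k then x n ^ k else 0)"
      using finite_multi_indices_mdeg[of "Suc n" j] last_index_in_multi_indices[of n k]
        mdeg_last_index[of n k]
      by (subst sum.delta) auto
    finally show ?thesis
      using 1 by (simp add: distrib_right sum.distrib)
  qed
  then show ?thesis
    unfolding homogeneous_poly_iff by (intro exI[of _ "\<lambda>\<alpha>. c1 \<alpha> + c2 \<alpha>"] ballI)
qed

lemma has_ord_suspension:
  assumes "has_ord n f m" "0 < k"
  shows "has_ord (Suc n) (suspension n k f) (min m k)"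
proof -
  obtain P where P: "\<And>j. homogeneous_poly n j (P j)"
    "eventually (\<lambda>x. (\<lambda>j. P j x) sums f x) (near_origin n)"
    "\<And>j x. j < m \<Longrightarrow> x \<in> Cn n \<Longrightarrow> P j x = 0" "\<exists>x\<in>Cn n. P m x \<noteq> 0"
    using assms(1) unfolding has_ord_def by blast
  define Q where "Q j x = P j (x(n := 0)) + (if j = k then x n ^ k else 0)" for j x
  have "homogeneous_poly (Suc n) j (Q j)" for j
    unfolding Q_def using P(1) by (rule homogeneous_poly_suspension)
  moreover have "eventually (\<lambda>x. (\<lambda>j. Q j x) sums suspension n k f x) (near_origin (Suc n))"
    using eventually_near_origin_upd[OF P(2)]
  proof eventually_elim
    case (elim x)
    then show ?case
      unfolding Q_def suspension_def by (intro sums_add sums_single)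
  qed
  moreover have "Q j x = 0" if "j < min m k" "x \<in> Cn (Suc n)" for j x
    using that P(3) upd_in_Cn_iff[of x n] by (simp add: Q_def del: fun_upd_apply)
  moreover have "\<exists>x\<in>Cn (Suc n). Q (min m k) x \<noteq> 0"
  proof (cases "m \<le> k")
    case True
    obtain x where x: "x \<in> Cn n" "P m x \<noteq> 0" using P(4) by blast
    then have "x n = 0" by (simp add: Cn_def)
    then have "x(n := 0) = x" by auto
    \<comment> \<open>At a point with last coordinate 0 the added power contributes nothing, since
      \<open>0 < k\<close>; so nothing cancels, even when \<open>m = k\<close>.\<close>
    then show ?thesis
      using x True \<open>x n = 0\<close> \<open>0 < k\<close> Cn_mono_Suc[of x n]
      by (intro bexI[of _ x]) (auto simp: Q_def power_0_left)
  next
    case False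
    \<comment> \<open>Here \<open>k < m\<close>, so \<open>P k\<close> vanishes and the unit point
      on the new axis detects the added power.\<close>
    have "origin(n := 1, n := 0) = origin" by auto
    moreover have "P k origin = 0" using False P(3) origin_in_Cn by simp
    ultimately have "Q k (origin(n := 1)) \<noteq> 0" by (simp add: Q_def)
    moreover have "origin(n := 1) \<in> Cn (Suc n)" by (simp add: Cn_def)
    ultimately show ?thesis using False by (metis min.absorb2 nle_le)
  qed
  ultimately show ?thesis unfolding has_ord_def by blast
qed

section \<open>Reducedness of suspensions\<close>

text \<open>At a zero of \<open>p\<close> the product has derivative 0, so
  \<open>of_nat k * z ^ (k - 1) = 0\<close>. This forces \<open>z = 0\<close> (and is impossible for
  \<open>k = 1\<close>), and evaluating the equation at 0 gives \<open>w = 0\<close>.\<close>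

lemma square_divisor_zero:
  assumes hol: "p holomorphic_on ball 0 r" "q holomorphic_on ball 0 r"
    and eq: "\<And>z. z \<in> ball 0 r \<Longrightarrow> p z * p z * q z = w + z ^ k"
    and "0 < k" "z \<in> ball 0 r" "p z = 0"
  shows "w = (0::complex)"
proof -
  obtain p' q' where p': "(p has_field_derivative p') (at z)" and q': "(q has_field_derivative q') (at z)"
    using hol \<open>z \<in> ball 0 r\<close> by (meson holomorphic_on_open open_ball)
  have "((\<lambda>z. p z * p z * q z) has_field_derivative 0) (at z)"
    by (rule derivative_eq_intros p' q' refl)+ (simp add: \<open>p z = 0\<close>)
  then have "((\<lambda>z. w + z ^ k) has_field_derivative 0) (at z)"
    using open_ball \<open>z \<in> ball 0 r\<close> eq by (rule has_field_derivative_transform_within_open)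
  moreover have "((\<lambda>z. w + z ^ k) has_field_derivative of_nat k * z ^ (k - 1)) (at z)"
    by (auto intro!: derivative_eq_intros)
  ultimately have "of_nat k * z ^ (k - 1) = 0"
    using DERIV_unique by blast
  then have "z = 0" using \<open>0 < k\<close> by simp
  then show ?thesis using eq[OF \<open>z \<in> ball 0 r\<close>] \<open>p z = 0\<close> \<open>0 < k\<close> by (simp add: power_0_left)
qed

text \<open>If \<open>p\<close> had no zero in the disc, Cauchy's inequality for the zeroth
  derivative of \<open>1 / p\<close> would bound \<open>1 / cmod (p 0)\<close> by
  \<open>1 / b\<close>.\<close>

lemma minimum_modulus_disc:
  assumes hol: "p holomorphic_on S" and "open S" "cball 0 e \<subseteq> S" "0 < e" "0 < b"
    and circle: "\<And>z. cmod z = e \<Longrightarrow> b \<le> cmod (p z)" and "cmod (p 0) < b"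
  shows "\<exists>z\<in>cball 0 e. p z = 0"
proof (rule ccontr)
  assume "\<not> ?thesis"
  then have nz: "p z \<noteq> 0" if "z \<in> cball 0 e" for z using that by blast
  have "(\<lambda>z. 1 / p z) holomorphic_on cball 0 e"
    using holomorphic_on_subset[OF hol \<open>cball 0 e \<subseteq> S\<close>] nz by (intro holomorphic_intros) auto
  then have "cmod ((deriv ^^ 0) (\<lambda>z. 1 / p z) 0) \<le> fact 0 * (1 / b) / e ^ 0"
  proof (intro Cauchy_inequality)
    show "cmod (1 / p z) \<le> 1 / b" if "cmod (0 - z) = e" for z
      using circle[of z] that \<open>0 < b\<close> by (simp add: norm_divide frac_le)
  qed (use \<open>0 < e\<close> in \<open>auto intro: holomorphic_on_imp_continuous_on holomorphic_on_subset\<close>)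
  then have "1 / cmod (p 0) \<le> 1 / b"
    by (simp add: norm_divide)
  moreover have "0 < cmod (p 0)" using nz[of 0] \<open>0 < e\<close> by simp
  ultimately show False
    using \<open>cmod (p 0) < b\<close> \<open>0 < b\<close> by (simp add: divide_simps split: if_splits)
qed

text \<open>If \<open>p\<^sup>2 q = f + z\<^sup>k\<close> and \<open>p\<close> vanishes at the origin, then for small \<open>x\<close> the slice \<open>p (x, \<cdot>)\<close>
  still has a zero, by the minimum modulus principle on a disc on whose boundary
  \<open>\<bar>p\<bar>\<^sup>2 \<bar>q\<bar> \<ge> \<epsilon>\<^sup>k / 2\<close>. It would be a multiple root of \<open>f x + z\<^sup>k\<close>, which has only simple roots
  when \<open>f x \<noteq> 0\<close>.\<close>

lemma no_square_divisor_suspension: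
  assumes p: "holomorphic_germ (Suc n) p" and q: "holomorphic_germ (Suc n) q"
    and f: "holomorphic_germ n f" "f origin = 0"
    and eq: "eventually (\<lambda>x. suspension n k f x = p x * p x * q x) (near_origin (Suc n))"
    and "0 < k" "p origin = 0"
  shows "eventually (\<lambda>x. f x = 0) (near_origin n)"
proof -
  obtain c1 r1 where r1: "0 < r1" and p1: "expands (Suc n) c1 r1 origin p"
    using holomorphic_germ_expands[OF p] by blast
  obtain c2 r2 where r2: "0 < r2" and q2: "expands (Suc n) c2 r2 origin q"
    using holomorphic_germ_expands[OF q] by blast
  obtain r3 where r3: "0 < r3" and eq3: "\<And>x. x \<in> Cn (Suc n) \<Longrightarrow> \<forall>i<Suc n. cmod (x i) < r3 \<Longrightarrow>
      suspension n k f x = p x * p x * q x"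
    using eq unfolding eventually_near_origin by blast
  define r where "r = min r1 (min r2 r3)"
  have r: "0 < r" "r \<le> r1" "r \<le> r2" "r \<le> r3" using r1 r2 r3 by (auto simp: r_def)
  define e where "e = r / 2"
  have e: "0 < e" "e < r" using r by (auto simp: e_def)
  obtain M where M: "0 < M" "\<And>x. x \<in> Cn (Suc n) \<Longrightarrow> \<forall>i<Suc n. cmod (x i) \<le> e \<Longrightarrow> cmod (q x) \<le> M"
    using expands_bounded[OF q2, of e] e r by auto
  \<comment> \<open>On the circle \<open>cmod z = e\<close> the modulus of
    \<open>f x + z ^ k\<close> will be at least \<open>e ^ k / 2\<close>, while \<open>q\<close> is
    bounded by \<open>M\<close>; hence \<open>p\<close> has modulus at least \<open>b\<close>
    there.\<close>
  define b where "b = sqrt (e ^ k / (2 * M))"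
  have b: "0 < b" "b\<^sup>2 = e ^ k / (2 * M)"
    using e M by (auto simp: b_def)
  have "eventually (\<lambda>x. dist (p x) (p origin) < b) (near_origin (Suc n))"
    using holomorphic_germ_tendsto[OF p] b(1) by (rule tendstoD)
  then obtain s where s: "0 < s" "\<And>x. x \<in> Cn (Suc n) \<Longrightarrow> \<forall>i<Suc n. cmod (x i) < s \<Longrightarrow> cmod (p x) < b"
    using \<open>p origin = 0\<close> unfolding eventually_near_origin by (auto simp: dist_norm)
  have "0 < e ^ k / 2" using e by simp
  with holomorphic_germ_tendsto[OF f(1)]
  have "eventually (\<lambda>x. dist (f x) (f origin) < e ^ k / 2) (near_origin n)"
    by (rule tendstoD)
  then obtain t where t: "0 < t" "\<And>x. x \<in> Cn n \<Longrightarrow> \<forall>i<n. cmod (x i) < t \<Longrightarrow> cmod (f x) < e ^ k / 2"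
    using f(2) unfolding eventually_near_origin by (auto simp: dist_norm)
  \<comment> \<open>The three bounds have separate tasks: \<open>e\<close> keeps the slice where
    \<open>q\<close> is bounded by \<open>M\<close>, \<open>s\<close> makes \<open>p\<close> smaller
    than \<open>b\<close> at the centre of the disc, and \<open>t\<close> keeps \<open>f x\<close>
    below half of \<open>e ^ k\<close>.\<close>
  have "f x = 0" if x: "x \<in> Cn n" and small: "\<forall>i<n. cmod (x i) < min e (min s t)" for x
  proof -
    have "x n = 0" using x by (simp add: Cn_def)
    have slice: "x(n := z) \<in> Cn (Suc n)" for z using x by (simp add: Cn_def)
    have upd: "x(n := z, n := 0) = x" for z using \<open>x n = 0\<close> by auto
    have xr: "cmod (x i) < r" if "i < n" for i using small e that by force
    have eqx: "p (x(n := z)) * p (x(n := z)) * q (x(n := z)) = f x + z ^ k" if "z \<in> ball 0 r" for z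
    proof -
      have "\<forall>i<Suc n. cmod ((x(n := z)) i) < r3"
        using that xr r by (auto simp: less_Suc_eq intro: less_le_trans)
      from eq3[OF slice this] show ?thesis
        by (simp only: suspension_def upd fun_upd_same)
    qed
    have hol_p: "(\<lambda>z. p (x(n := z))) holomorphic_on ball 0 r"
      by (rule holomorphic_on_subset[OF expands_holomorphic_slice[OF p1 x]])
        (use xr r in \<open>auto intro: less_le_trans\<close>)
    have hol_q: "(\<lambda>z. q (x(n := z))) holomorphic_on ball 0 r"
      by (rule holomorphic_on_subset[OF expands_holomorphic_slice[OF q2 x]])
        (use xr r in \<open>auto intro: less_le_trans\<close>)
    have "\<exists>z\<in>cball 0 e. p (x(n := z)) = 0"
    proof (rule minimum_modulus_disc[OF hol_p open_ball])
      show "cball 0 e \<subseteq> ball (0::complex) r" using e by auto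
      show "cmod (p (x(n := 0))) < b"
        by (rule s(2)[OF slice]) (use small s(1) in \<open>auto simp: less_Suc_eq\<close>)
      fix z :: complex assume z: "cmod z = e"
      then have z_ball: "z \<in> ball 0 r" using e by simp
      have "cmod (f x) < e ^ k / 2" using small by (intro t(2)[OF x]) auto
      then have "e ^ k / 2 \<le> cmod (f x + z ^ k)"
        using norm_diff_ineq[of "z ^ k" "f x"] z by (simp add: norm_power add.commute)
      also have "\<dots> = cmod (p (x(n := z))) ^ 2 * cmod (q (x(n := z)))"
        unfolding eqx[OF z_ball, symmetric] by (simp add: norm_mult power2_eq_square)
      also have "\<dots> \<le> cmod (p (x(n := z))) ^ 2 * M"
        by (intro mult_left_mono M(2)[OF slice])
          (use small z in \<open>auto simp: less_Suc_eq intro: less_imp_le\<close>)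
      finally have "e ^ k / 2 \<le> cmod (p (x(n := z))) ^ 2 * M" .
      then have "b\<^sup>2 \<le> cmod (p (x(n := z))) ^ 2"
        unfolding b(2) using M(1) by (simp add: field_simps)
      then show "b \<le> cmod (p (x(n := z)))"
        by (rule power2_le_imp_le) simp
    qed (use e b in auto)
    then obtain z where z: "z \<in> cball 0 e" "p (x(n := z)) = 0" by blast
    then have "z \<in> ball 0 r" using e by simp
    with z show "f x = 0"
      using square_divisor_zero[OF hol_p hol_q eqx \<open>0 < k\<close>] by blast
  qed
  moreover have "0 < min e (min s t)" using e s t by simp
  ultimately show ?thesis
    unfolding eventually_near_origin by blast
qed

section \<open>Units and square factors in the germ ring\<close>

lemma carrier_germ_ring: "carrier (germ_ring n) = germ n ` {f. holomorphic_germ n f}"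
  by (simp add: germ_ring_def)

text \<open>Since irreducible elements are not units, this makes every irreducible germ vanish at
  the origin.\<close>

lemma germ_in_Units:
  assumes "holomorphic_germ n p" "p origin \<noteq> 0"
  shows "germ n p \<in> Units (germ_ring n)"
proof -
  have "eventually (\<lambda>x. p x \<noteq> 0) (near_origin n)"
    using holomorphic_germ_tendsto[OF assms(1)] assms(2) by (rule tendsto_imp_eventually_ne)
  then have "germ n (\<lambda>x. 1 / p x * p x) = germ n (\<lambda>_. 1)" "germ n (\<lambda>x. p x * (1 / p x)) = germ n (\<lambda>_. 1)"
    unfolding germ_eq_iff by (eventually_elim, simp)+
  then have "germ n (\<lambda>x. 1 / p x) \<otimes>\<^bsub>germ_ring n\<^esub> germ n p = \<one>\<^bsub>germ_ring n\<^esub>"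
    "germ n p \<otimes>\<^bsub>germ_ring n\<^esub> germ n (\<lambda>x. 1 / p x) = \<one>\<^bsub>germ_ring n\<^esub>"
    unfolding germ_ring_mult by (simp_all add: germ_ring_def)
  moreover have "germ n p \<in> carrier (germ_ring n)" "germ n (\<lambda>x. 1 / p x) \<in> carrier (germ_ring n)"
    using assms holomorphic_germ_inverse by (auto simp: carrier_germ_ring)
  ultimately show ?thesis unfolding Units_def by blast
qed

lemma reduced_germ_suspension:
  assumes f: "holomorphic_germ n f" "f origin = 0" "germ n f \<noteq> \<zero>\<^bsub>germ_ring n\<^esub>" and "0 < k"
  shows "reduced_germ (Suc n) (suspension n k f)"
  unfolding reduced_germ_def
proof (intro conjI notI)
  have contra: False if "holomorphic_germ (Suc n) p" "holomorphic_germ (Suc n) q" "p origin = 0"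
    "germ (Suc n) (suspension n k f) = germ (Suc n) (\<lambda>x. p x * p x * q x)" for p q
    using no_square_divisor_suspension[OF that(1,2) f(1,2) _ \<open>0 < k\<close> that(3)] that(4) f(3)
    by (simp add: germ_eq_iff germ_ring_zero)
  have "expands (Suc n) (\<lambda>_. 0) 1 a (\<lambda>_. 0)" for a
    by (simp add: expands_def)
  then have zero: "holomorphic_germ (Suc n) (\<lambda>_. 0)"
    unfolding holomorphic_germ_iff by (intro always_eventually allI) (use zero_less_one in blast)
  \<comment> \<open>A zero suspension would be the product \<open>p * p * q\<close> with
    \<open>p\<close> and \<open>q\<close> both zero, so the same contradiction covers it.\<close>
  show False if "germ (Suc n) (suspension n k f) = \<zero>\<^bsub>germ_ring (Suc n)\<^esub>"
    using contra[OF zero zero] that by (simp add: germ_ring_zero)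
  show False if div: "\<exists>p\<in>carrier (germ_ring (Suc n)). ring_irreducible\<^bsub>germ_ring (Suc n)\<^esub> p \<and>
    (p \<otimes>\<^bsub>germ_ring (Suc n)\<^esub> p) divides\<^bsub>germ_ring (Suc n)\<^esub> germ (Suc n) (suspension n k f)"
  proof -
    obtain p q where p: "holomorphic_germ (Suc n) p" and q: "holomorphic_germ (Suc n) q"
      and irr: "ring_irreducible\<^bsub>germ_ring (Suc n)\<^esub> (germ (Suc n) p)"
      and eq: "germ (Suc n) (suspension n k f) = germ (Suc n) (\<lambda>x. p x * p x * q x)"
      using div by (auto simp: factor_def carrier_germ_ring germ_ring_mult)
    have "p origin = 0"
      using irr germ_in_Units[OF p] unfolding ring_irreducible_def irreducible_def by blast
    then show False using contra[OF p q _ eq] by blast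
  qed
qed

theorem proposition4p1:
  assumes A: "\<forall>n\<ge>1. \<forall>f g.
      holomorphic_germ n f \<longrightarrow> f origin = 0 \<longrightarrow> reduced_germ n f \<longrightarrow>
      holomorphic_germ n g \<longrightarrow> g origin = 0 \<longrightarrow> reduced_germ n g \<longrightarrow>
      topologically_right_equivalent n f g \<longrightarrow>
      [zero_set_mult n f = zero_set_mult n g] (mod 2)"
  shows "\<forall>n\<ge>1. \<forall>f g.
      holomorphic_germ n f \<longrightarrow> f origin = 0 \<longrightarrow> reduced_germ n f \<longrightarrow>
      holomorphic_germ n g \<longrightarrow> g origin = 0 \<longrightarrow> reduced_germ n g \<longrightarrow>
      topologically_right_equivalent n f g \<longrightarrow>
      zero_set_mult n f = zero_set_mult n g"
proof (intro allI impI)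
  fix n :: nat and f g
  assume f: "holomorphic_germ n f" "f origin = 0" "reduced_germ n f"
    and g: "holomorphic_germ n g" "g origin = 0" "reduced_germ n g"
    and fg: "topologically_right_equivalent n f g"
  have nz: "germ n f \<noteq> \<zero>\<^bsub>germ_ring n\<^esub>" "germ n g \<noteq> \<zero>\<^bsub>germ_ring n\<^esub>"
    using f(3) g(3) by (simp_all add: reduced_germ_def)
  obtain m m' where m: "has_ord n f m" and m': "has_ord n g m'"
    using has_ord_exists[OF f(1) nz(1)] has_ord_exists[OF g(1) nz(2)] by blast
  define k where "k = Suc (min m m')"
  have "0 < k" by (simp add: k_def)
  have "suspension n k h origin = 0" if "h origin = 0" for h
  proof -
    have "origin(n := 0) = origin" by auto
    with that \<open>0 < k\<close> show ?thesis by (simp add: suspension_def)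
  qed
  \<comment> \<open>The parity hypothesis enters here, in dimension \<open>Suc n\<close>. The choice
    of \<open>k\<close> is symmetric in the two orders, so neither has to be assumed the smaller
    one.\<close>
  then have "[zero_set_mult (Suc n) (suspension n k f) = zero_set_mult (Suc n) (suspension n k g)] (mod 2)"
    using f(1,2) g(1,2) nz \<open>0 < k\<close> fg
    by (intro A[rule_format] holomorphic_germ_suspension reduced_germ_suspension
        topologically_right_equivalent_suspension) auto
  then have "[min m k = min m' k] (mod 2)"
    using germ_ord_eq[OF has_ord_suspension[OF m \<open>0 < k\<close>]]
      germ_ord_eq[OF has_ord_suspension[OF m' \<open>0 < k\<close>]]
    by (simp add: zero_set_mult_def)
  then have "m = m'"
    unfolding k_def cong_def by (cases m m' rule: linorder_cases) (simp_all add: min_def split: if_splits, presburger+)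
  then show "zero_set_mult n f = zero_set_mult n g"
    using germ_ord_eq[OF m] germ_ord_eq[OF m'] by (simp add: zero_set_mult_def)
qed

end
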